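(* With notation as in the context, the map $\Lambda$ is a $C^\infty$-diffeomorphism from $\Omega_{-,4}$ onto $\mathbb R^2_{<,+}$. Furthermore, let $|x|>0$, $u\in\mathbb R^2_{<,+}$, $x=|x|e_1$, $t=\frac{|x|^2}{4}(u,0)$ and $\theta=(\Lambda^{-1}(u),0)\in\mathbb R^3$. Then the Hessian matrix of $\tau\mapsto\phi((x,t);\tau)$ at $\tau=\theta$ is nonsingular and has exactly two positive eigenvalues.
   Context: Work in $N_{3,2}=\mathbb R^3\times\mathbb R^3$ (step-two group with $\sum_j\tau_jU^{(j)}=\begin{pmatrix}0&\tau_3&-\tau_2\\-\tau_3&0&\tau_1\\\tau_2&-\tau_1&0\end{pmatrix}$); $e_1,e_2$ standard basis vectors. $\psi(s)=(1-s\cot s)/s^2$ for $s\notin\pi\mathbb Z\setminus\{0\}$ ($\psi(0)=1/3$). For $\tau\in\mathbb R^3$ with $|\tau|\notin\pi\mathbb Z\setminus\{0\}$ and $(x,t)\in\mathbb R^3\times\mathbb R^3$, $\phi((x,t);\tau)=|x|^2|\tau|\cot|\tau|+\psi(|\tau|)\langle\tau,x\rangle^2+4t\cdot\tau$. $\vartheta_1$ is the unique solution of $\tan s=s$ in $(\pi,\frac32\pi)$. For $v=(v_1,v_2)\in\mathbb R^2$, $r=|v|$: $\Lambda(v)=v_2\big[\frac{\psi'(r)}{r}v_2v+2\psi(r)e_2\big]$ (with $e_2=(0,1)$ here), $\mathrm K_3(v)=2\psi(r)+\frac{\psi'(r)}{r}v_2^2$, $\Omega_{-,4}=\{v:\ v_2<0,\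 \pi<v_1<r<\vartheta_1,\ \mathrm K_3(v)<0\}$, and $\mathbb R^2_{<,+}=\{(u_1,u_2):u_1>0,\ 0<u_2<\frac2{\sqrt\pi}\sqrt{u_1}\}$. *)

theory Defs
  imports "HOL-Analysis.Analysis" "HOL-Computational_Algebra.Polynomial"
begin

fun Ck_on :: "nat \<Rightarrow> 'a::euclidean_space set \<Rightarrow> ('a \<Rightarrow> 'b::real_normed_vector) \<Rightarrow> bool" where
  "Ck_on 0 S f = continuous_on S f"
| "Ck_on (Suc k) S f =
     (\<exists>f'. (\<forall>x\<in>S. (f has_derivative f' x) (at x)) \<and> (\<forall>i\<in>Basis. Ck_on k S (\<lambda>x. f' x i)))"

definition smooth_on :: "'a::euclidean_space set \<Rightarrow> ('a \<Rightarrow> 'b::real_normed_vector) \<Rightarrow> bool" where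
  "smooth_on S f \<longleftrightarrow> (\<forall>k. Ck_on k S f)"

definition smooth_diffeo :: "('a::euclidean_space \<Rightarrow> 'b::euclidean_space) \<Rightarrow> 'a set \<Rightarrow> 'b set \<Rightarrow> bool" where
  "smooth_diffeo f S T \<longleftrightarrow> bij_betw f S T \<and> smooth_on S f \<and> smooth_on T (the_inv_into S f)"

definition partial :: "(real^'n \<Rightarrow> real) \<Rightarrow> 'n \<Rightarrow> real^'n \<Rightarrow> real" where
  "partial f i x = deriv (\<lambda>s. f (x + s *\<^sub>R axis i 1)) 0"

definition hessian :: "(real^'n \<Rightarrow> real) \<Rightarrow> real^'n \<Rightarrow> real^'n^'n" where
  "hessian f x = (\<chi> i j. partial (\<lambda>y. partial f j y) i x)"

definition charpoly :: "real^'n^'n \<Rightarrow> real poly" where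
  "charpoly A = det (\<chi> i j. (if i = j then [:0, 1:] else 0) - [:A $ i $ j:])"

definition num_pos_eigenvalues :: "real^'n^'n \<Rightarrow> nat" where
  "num_pos_eigenvalues A = (\<Sum>a\<in>{a. a > 0 \<and> poly (charpoly A) a = 0}. order a (charpoly A))"

definition psi :: "real \<Rightarrow> real" where
  "psi s = (if s = 0 then 1/3 else (1 - s * cot s) / s^2)"

definition phi :: "real^3 \<Rightarrow> real^3 \<Rightarrow> real^3 \<Rightarrow> real" where
  "phi x t \<tau> = (norm x)^2 * norm \<tau> * cot (norm \<tau>) + psi (norm \<tau>) * (\<tau> \<bullet> x)^2 + 4 * (t \<bullet> \<tau>)"

definition vartheta1 :: real where
  "vartheta1 = (THE s. pi < s \<and> s < 3/2 * pi \<and> tan s = s)"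

definition Lambda :: "real^2 \<Rightarrow> real^2" where
  "Lambda v = (let r = norm v in
     (v $ 2) *\<^sub>R ((deriv psi r / r * v $ 2) *\<^sub>R v + (2 * psi r) *\<^sub>R axis 2 1))"

definition K3 :: "real^2 \<Rightarrow> real" where
  "K3 v = (let r = norm v in 2 * psi r + deriv psi r / r * (v $ 2)^2)"

definition Omega_m4 :: "(real^2) set" where
  "Omega_m4 = {v. v $ 2 < 0 \<and> pi < v $ 1 \<and> v $ 1 < norm v \<and> norm v < vartheta1 \<and> K3 v < 0}"

definition R2_lt_plus :: "(real^2) set" where
  "R2_lt_plus = {u. u $ 1 > 0 \<and> 0 < u $ 2 \<and> u $ 2 < 2 / sqrt pi * sqrt (u $ 1)}"

end

theory Submission
  imports Defs
begin

text \<open>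
  Write \<open>\<psi>(r) = G(\<rho>)\<close> with \<open>\<rho> = r\<^sup>2\<close>. Then \<open>\<Lambda>\<close> is the gradient of \<open>F(v) = G(|v|\<^sup>2) v\<^sub>2\<^sup>2\<close>, and
  on \<open>\<pi> < |\<tau>| < \<theta>\<^sub>1\<close> the function \<open>\<phi>\<close> equals \<open>|x|\<^sup>2 (1 - G(|\<tau>|\<^sup>2)(\<tau>\<^sub>2\<^sup>2 + \<tau>\<^sub>3\<^sup>2) + u \<bullet> \<tau>)\<close>. Hence the
  Hessian at \<open>(v, 0)\<close> is, up to the factor \<open>-|x|\<^sup>2\<close>, the block matrix of \<open>D\<Lambda>(v)\<close> and \<open>K\<^sub>3(v) < 0\<close>, and
  \<open>det D\<Lambda> < 0\<close> gives the signature as well as the smoothness of the inverse. Up to the factor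
  \<open>4 v\<^sub>2\<^sup>2 > 0\<close> this determinant is affine in \<open>w = v\<^sub>2\<^sup>2\<close> and negative at \<open>w = 0\<close> and where \<open>K\<^sub>3 = 0\<close>.

  For bijectivity put \<open>E = -1/G\<close>, which is convex and increasing in \<open>\<rho>\<close> and vanishes at \<open>\<pi>\<^sup>2\<close>, and
  \<open>m = w / E\<^sup>2\<close>, so that \<open>u\<^sub>1 = 2 m E' v\<^sub>1\<close> and \<open>u\<^sub>2 = 2 \<surd>m (1 - m E E')\<close>. For fixed \<open>u\<^sub>1\<close>, increasing \<open>\<rho>\<close>
  decreases \<open>m\<close> and increases \<open>w / \<rho>\<close>, hence strictly decreases \<open>u\<^sub>2 = 2 \<surd>m - u\<^sub>1 \<surd>w / v\<^sub>1\<close>: this is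
  injectivity. The image is open by invariance of domain, and closed in the connected target because
  \<open>\<rho> \<rightarrow> \<pi>\<^sup>2\<close> forces \<open>u\<^sub>2 = 2 \<surd>(u\<^sub>1 / \<pi>)\<close> and \<open>\<rho> \<rightarrow> \<theta>\<^sub>1\<^sup>2\<close> forces \<open>u\<^sub>2 \<rightarrow> 0\<close> in the limit.
\<close>

section \<open>Calculus of \<open>C\<^sup>k\<close> functions\<close>

lemma Ck_on_SucI:
  assumes "\<And>x. x \<in> S \<Longrightarrow> (f has_derivative f' x) (at x)"
    and "\<And>i. i \<in> Basis \<Longrightarrow> Ck_on k S (\<lambda>x. f' x i)"
  shows "Ck_on (Suc k) S f"
  using assms by auto

lemma Ck_on_SucE:
  assumes "Ck_on (Suc k) S f"
  obtains f' where "\<And>x. x \<in> S \<Longrightarrow> (f has_derivative f' x) (at x)"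
    and "\<And>i. i \<in> Basis \<Longrightarrow> Ck_on k S (\<lambda>x. f' x i)"
  using assms by auto

lemma Ck_on_Suc_imp: "Ck_on (Suc k) S f \<Longrightarrow> Ck_on k S f"
proof (induction k arbitrary: f)
  case 0
  then obtain f' where "\<And>x. x \<in> S \<Longrightarrow> (f has_derivative f' x) (at x)"
    by (auto)
  then show ?case
    by (auto intro!: has_derivative_continuous continuous_at_imp_continuous_on)
next
  case (Suc k)
  obtain f' where f': "\<And>x. x \<in> S \<Longrightarrow> (f has_derivative f' x) (at x)"
    "\<And>i. i \<in> Basis \<Longrightarrow> Ck_on (Suc k) S (\<lambda>x. f' x i)"
    by (fact Ck_on_SucE[OF Suc.prems])
  show ?case
    using f'(1) Suc.IH[OF f'(2)] by (rule Ck_on_SucI)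
qed

lemma Ck_on_cong:
  assumes "open S" "\<And>x. x \<in> S \<Longrightarrow> f x = g x"
  shows "Ck_on k S f \<longleftrightarrow> Ck_on k S g"
proof -
  have *: "Ck_on k S g" if eq: "\<And>x. x \<in> S \<Longrightarrow> f x = g x" and f: "Ck_on k S f" for f g :: "'a \<Rightarrow> 'b"
  proof (cases k)
    case 0
    with that show ?thesis by (simp cong: continuous_on_cong)
  next
    case (Suc j)
    obtain f' where f': "\<And>x. x \<in> S \<Longrightarrow> (f has_derivative f' x) (at x)"
      "\<And>i. i \<in> Basis \<Longrightarrow> Ck_on j S (\<lambda>x. f' x i)"
      by (fact Ck_on_SucE[OF f[unfolded Suc]])
    have "(g has_derivative f' x) (at x)" if "x \<in> S" for x
      using f'(1)[OF that] \<open>open S\<close> that eq by (rule has_derivative_transform_within_open)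
    then show ?thesis
      unfolding Suc using f'(2) by (rule Ck_on_SucI)
  qed
  show ?thesis
    using *[of f g] *[of g f] assms(2) by auto
qed

lemma Ck_on_const [simp]: "Ck_on k S (\<lambda>x. c)"
proof (induction k arbitrary: c)
  case (Suc k)
  show ?case
    by (rule Ck_on_SucI[where f' = "\<lambda>_ _. 0"]) (use Suc in auto)
qed auto

lemma Ck_on_bounded_linear_comp:
  assumes h: "bounded_linear h" and f: "Ck_on k S f"
  shows "Ck_on k S (\<lambda>x. h (f x))"
  using f
proof (induction k arbitrary: f)
  case 0
  with h show ?case
    by (auto intro: bounded_linear.continuous_on)
next
  case (Suc k)
  obtain f' where f': "\<And>x. x \<in> S \<Longrightarrow> (f has_derivative f' x) (at x)"
    "\<And>i. i \<in> Basis \<Longrightarrow> Ck_on k S (\<lambda>x. f' x i)"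
    by (fact Ck_on_SucE[OF Suc.prems])
  show ?case
    by (rule Ck_on_SucI[OF bounded_linear.has_derivative[OF h f'(1)] Suc.IH[OF f'(2)]])
qed

lemma Ck_on_bounded_linear:
  assumes h: "bounded_linear h"
  shows "Ck_on k S h"
proof (cases k)
  case 0
  with h show ?thesis by (auto intro: linear_continuous_on)
next
  case (Suc j)
  show ?thesis
    unfolding Suc
    by (rule Ck_on_SucI[where f' = "\<lambda>_. h"]) (use h in \<open>auto intro: bounded_linear_imp_has_derivative\<close>)
qed

lemma Ck_on_add:
  "Ck_on k S f \<Longrightarrow> Ck_on k S g \<Longrightarrow> Ck_on k S (\<lambda>x. f x + g x)"
proof (induction k arbitrary: f g)
  case 0
  then show ?case by (auto intro: continuous_intros)
next
  case (Suc k)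
  obtain f' where f': "\<And>x. x \<in> S \<Longrightarrow> (f has_derivative f' x) (at x)"
    "\<And>i. i \<in> Basis \<Longrightarrow> Ck_on k S (\<lambda>x. f' x i)"
    by (fact Ck_on_SucE[OF Suc.prems(1)])
  obtain g' where g': "\<And>x. x \<in> S \<Longrightarrow> (g has_derivative g' x) (at x)"
    "\<And>i. i \<in> Basis \<Longrightarrow> Ck_on k S (\<lambda>x. g' x i)"
    by (fact Ck_on_SucE[OF Suc.prems(2)])
  show ?case
    by (rule Ck_on_SucI[OF has_derivative_add[OF f'(1) g'(1)] Suc.IH[OF f'(2) g'(2)]])
qed

lemma Ck_on_sum:
  "(\<And>i. i \<in> I \<Longrightarrow> Ck_on k S (f i)) \<Longrightarrow> Ck_on k S (\<lambda>x. \<Sum>i\<in>I. f i x)"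
  by (induction I rule: infinite_finite_induct) (auto intro: Ck_on_add)

lemma Ck_on_scaleR:
  "Ck_on k S f \<Longrightarrow> Ck_on k S g \<Longrightarrow> Ck_on k S (\<lambda>x. f x *\<^sub>R g x)"
proof (induction k arbitrary: f g)
  case 0
  then show ?case by (auto intro: continuous_intros)
next
  case (Suc k)
  obtain f' where f': "\<And>x. x \<in> S \<Longrightarrow> (f has_derivative f' x) (at x)"
    "\<And>i. i \<in> Basis \<Longrightarrow> Ck_on k S (\<lambda>x. f' x i)"
    by (fact Ck_on_SucE[OF Suc.prems(1)])
  obtain g' where g': "\<And>x. x \<in> S \<Longrightarrow> (g has_derivative g' x) (at x)"
    "\<And>i. i \<in> Basis \<Longrightarrow> Ck_on k S (\<lambda>x. g' x i)"
    by (fact Ck_on_SucE[OF Suc.prems(2)])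
  show ?case
    by (rule Ck_on_SucI[OF has_derivative_scaleR[OF f'(1) g'(1)]])
      (use Suc.IH f'(2) g'(2) Suc.prems[THEN Ck_on_Suc_imp] in \<open>auto intro: Ck_on_add\<close>)
qed

lemma Ck_on_mult:
  fixes f g :: "'a::euclidean_space \<Rightarrow> real"
  shows "Ck_on k S f \<Longrightarrow> Ck_on k S g \<Longrightarrow> Ck_on k S (\<lambda>x. f x * g x)"
  using Ck_on_scaleR[of k S f g] by simp

lemma Ck_on_compose:
  fixes f :: "'a::euclidean_space \<Rightarrow> 'b::euclidean_space" and g :: "'b \<Rightarrow> 'c::real_normed_vector"
  assumes "Ck_on k S f" "Ck_on k T g" "f ` S \<subseteq> T"
  shows "Ck_on k S (\<lambda>x. g (f x))"
  using assms
proof (induction k arbitrary: g)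
  case 0
  then show ?case by (auto intro: continuous_on_compose2)
next
  case (Suc k)
  obtain f' where f': "\<And>x. x \<in> S \<Longrightarrow> (f has_derivative f' x) (at x)"
    "\<And>i. i \<in> Basis \<Longrightarrow> Ck_on k S (\<lambda>x. f' x i)"
    by (fact Ck_on_SucE[OF Suc.prems(1)])
  obtain g' where g': "\<And>x. x \<in> T \<Longrightarrow> (g has_derivative g' x) (at x)"
    "\<And>i. i \<in> Basis \<Longrightarrow> Ck_on k T (\<lambda>x. g' x i)"
    by (fact Ck_on_SucE[OF Suc.prems(2)])
  \<comment> \<open>\<open>Ck_on\<close> controls derivatives in basis directions only, so
    \<open>g' (f x)\<close> applied to \<open>f' x i\<close> is expanded over the basis of the
    middle space; each summand is then covered by the induction hypothesis.\<close>
  define h where "h x i = (\<Sum>j\<in>Basis. (f' x i \<bullet> j) *\<^sub>R g' (f x) j)" for x i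
  have "((\<lambda>x. g (f x)) has_derivative h x) (at x)" if "x \<in> S" for x
  proof -
    have fx: "f x \<in> T" using that Suc.prems(3) by auto
    have "h x = (\<lambda>i. g' (f x) (f' x i))"
    proof
      fix i
      have "linear (g' (f x))" using g'(1)[OF fx] has_derivative_linear by blast
      then show "h x i = g' (f x) (f' x i)"
        unfolding h_def
        by (subst (2) euclidean_representation[symmetric, of "f' x i"])
          (simp only: linear_sum linear_scale)
    qed
    then show ?thesis
      using has_derivative_compose[OF f'(1)[OF that] g'(1)[OF fx]] by simp
  qed
  moreover have "Ck_on k S (\<lambda>x. h x i)" if "i \<in> Basis" for i
    unfolding h_def
    by (intro Ck_on_sum Ck_on_scaleR Ck_on_bounded_linear_comp[OF bounded_linear_inner_left]
        f'(2)[OF that] Suc.IH g'(2) Suc.prems Ck_on_Suc_imp[OF Suc.prems(1)])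
  ultimately show ?case
    by (rule Ck_on_SucI)
qed

section \<open>One-variable building blocks and closure rules\<close>

lemma Ck_on_real_SucI:
  fixes f :: "real \<Rightarrow> real"
  assumes "\<And>x. x \<in> S \<Longrightarrow> (f has_field_derivative f' x) (at x)" "Ck_on k S f'"
  shows "Ck_on (Suc k) S f"
  by (rule Ck_on_SucI[where f' = "\<lambda>x. (*) (f' x)"])
    (use assms in \<open>auto simp: has_field_derivative_def\<close>)

lemma Ck_on_inverse_real: "0 \<notin> S \<Longrightarrow> Ck_on k S (inverse :: real \<Rightarrow> real)"
proof (induction k)
  case 0
  then show ?case by (auto intro!: continuous_intros)
next
  case (Suc k)
  show ?case
  proof (rule Ck_on_real_SucI)
    show "(inverse has_field_derivative (-1) * (inverse x * inverse x)) (at x)" if "x \<in> S" for x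
      using that Suc.prems by (auto intro!: derivative_eq_intros simp: power2_eq_square)
    show "Ck_on k S (\<lambda>x. (-1) * (inverse x * inverse x))"
      using Suc by (intro Ck_on_mult Ck_on_const) auto
  qed
qed

lemma smooth_on_imp_continuous_on: "smooth_on S f \<Longrightarrow> continuous_on S f"
  unfolding smooth_on_def by (metis Ck_on.simps(1))

lemma smooth_on_cong:
  "open S \<Longrightarrow> (\<And>x. x \<in> S \<Longrightarrow> f x = g x) \<Longrightarrow> smooth_on S f \<longleftrightarrow> smooth_on S g"
  unfolding smooth_on_def using Ck_on_cong by blast

lemma Ck_on_subset: "Ck_on k S f \<Longrightarrow> T \<subseteq> S \<Longrightarrow> Ck_on k T f"
proof (induction k arbitrary: f)
  case 0
  then show ?case by (auto intro: continuous_on_subset)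
next
  case (Suc k)
  obtain f' where "\<And>x. x \<in> S \<Longrightarrow> (f has_derivative f' x) (at x)"
    "\<And>i. i \<in> Basis \<Longrightarrow> Ck_on k S (\<lambda>x. f' x i)"
    by (fact Ck_on_SucE[OF Suc.prems(1)])
  with Suc show ?case
    by (intro Ck_on_SucI[of T f f']) auto
qed

lemma smooth_on_subset: "smooth_on S f \<Longrightarrow> T \<subseteq> S \<Longrightarrow> smooth_on T f"
  unfolding smooth_on_def using Ck_on_subset by blast

lemma smooth_on_const: "smooth_on S (\<lambda>x. c)"
  by (simp add: smooth_on_def)

lemma smooth_on_bounded_linear: "bounded_linear h \<Longrightarrow> smooth_on S h"
  by (simp add: smooth_on_def Ck_on_bounded_linear)

lemma smooth_on_add: "smooth_on S f \<Longrightarrow> smooth_on S g \<Longrightarrow> smooth_on S (\<lambda>x. f x + g x)"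
  by (simp add: smooth_on_def Ck_on_add)

lemma smooth_on_scaleR:
  "smooth_on S f \<Longrightarrow> smooth_on S g \<Longrightarrow> smooth_on S (\<lambda>x. f x *\<^sub>R g x)"
  by (simp add: smooth_on_def Ck_on_scaleR)

lemma smooth_on_mult:
  fixes f g :: "'a::euclidean_space \<Rightarrow> real"
  shows "smooth_on S f \<Longrightarrow> smooth_on S g \<Longrightarrow> smooth_on S (\<lambda>x. f x * g x)"
  by (simp add: smooth_on_def Ck_on_mult)

lemma smooth_on_minus:
  fixes f :: "'a::euclidean_space \<Rightarrow> real"
  shows "smooth_on S f \<Longrightarrow> smooth_on S (\<lambda>x. - f x)"
  using smooth_on_mult[OF smooth_on_const[of S "-1"], of f] by simp

lemma smooth_on_diff:
  fixes f g :: "'a::euclidean_space \<Rightarrow> real"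
  shows "smooth_on S f \<Longrightarrow> smooth_on S g \<Longrightarrow> smooth_on S (\<lambda>x. f x - g x)"
  using smooth_on_add[of S f "\<lambda>x. - g x"] smooth_on_minus[of S g] by simp

lemma smooth_on_power:
  fixes f :: "'a::euclidean_space \<Rightarrow> real"
  shows "smooth_on S f \<Longrightarrow> smooth_on S (\<lambda>x. f x ^ n)"
  by (induction n) (simp_all add: smooth_on_const smooth_on_mult)

lemma smooth_on_compose:
  fixes f :: "'a::euclidean_space \<Rightarrow> 'b::euclidean_space"
  shows "smooth_on S f \<Longrightarrow> smooth_on T g \<Longrightarrow> f ` S \<subseteq> T \<Longrightarrow> smooth_on S (\<lambda>x. g (f x))"
  unfolding smooth_on_def using Ck_on_compose by blast

lemma smooth_on_divide:
  fixes f g :: "'a::euclidean_space \<Rightarrow> real"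
  assumes "smooth_on S f" "smooth_on S g" "\<And>x. x \<in> S \<Longrightarrow> g x \<noteq> 0"
  shows "smooth_on S (\<lambda>x. f x / g x)"
proof -
  have "smooth_on S (\<lambda>x. inverse (g x))"
    using assms by (intro smooth_on_compose[of S g "- {0}" inverse])
      (auto simp: smooth_on_def Ck_on_inverse_real)
  then show ?thesis
    unfolding divide_inverse by (intro smooth_on_mult assms)
qed

lemma smooth_on_sqrt:
  assumes "smooth_on S f" "\<And>x. x \<in> S \<Longrightarrow> f x > 0"
  shows "smooth_on S (\<lambda>x. sqrt (f x))"
proof -
  have "Ck_on k {0<..} sqrt" for k
  proof (induction k)
    case 0
    then show ?case by (auto intro!: continuous_intros)
  next
    case (Suc k)
    show ?case
    proof (rule Ck_on_real_SucI)
      show "(sqrt has_field_derivative (1/2) * inverse (sqrt x)) (at x)" if "x \<in> {0<..}" for x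
        using that by (auto intro!: derivative_eq_intros simp: field_simps)
      show "Ck_on k {0<..} (\<lambda>x. (1/2) * inverse (sqrt x))"
        by (rule Ck_on_mult[OF Ck_on_const Ck_on_compose[OF Suc Ck_on_inverse_real[of "{0<..}"]]]) auto
    qed
  qed
  then show ?thesis
    using assms by (intro smooth_on_compose[of S f "{0<..}" sqrt]) (auto simp: smooth_on_def)
qed

lemma smooth_on_sin_cos:
  fixes f :: "'a::euclidean_space \<Rightarrow> real"
  assumes "smooth_on S f"
  shows smooth_on_sin: "smooth_on S (\<lambda>x. sin (f x))"
    and smooth_on_cos: "smooth_on S (\<lambda>x. cos (f x))"
proof -
  \<comment> \<open>Joint induction, since each function is the derivative of the other up to
    sign.\<close>
  have "Ck_on k UNIV (sin :: real \<Rightarrow> real) \<and> Ck_on k UNIV (cos :: real \<Rightarrow> real)" for k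
  proof (induction k)
    case 0
    then show ?case by (auto intro!: continuous_intros)
  next
    case (Suc k)
    then have "Ck_on k UNIV (\<lambda>x::real. (-1) * sin x)"
      by (intro Ck_on_mult Ck_on_const) auto
    with Suc show ?case
      by (intro conjI Ck_on_real_SucI[where f' = cos] Ck_on_real_SucI[where f' = "\<lambda>x. (-1) * sin x"])
        (auto intro!: derivative_eq_intros)
  qed
  then have "smooth_on UNIV (sin :: real \<Rightarrow> real)" "smooth_on UNIV (cos :: real \<Rightarrow> real)"
    by (auto simp: smooth_on_def)
  with assms show "smooth_on S (\<lambda>x. sin (f x))" "smooth_on S (\<lambda>x. cos (f x))"
    by (auto intro: smooth_on_compose)
qed

lemmas smooth_intros = smooth_on_const smooth_on_add smooth_on_diff smooth_on_minus smooth_on_mult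
  smooth_on_scaleR smooth_on_power smooth_on_divide smooth_on_sqrt smooth_on_sin smooth_on_cos

text \<open>Bootstrapping: the derivative of the inverse at \<open>y\<close> is \<open>g'\<close>
  evaluated at the preimage of \<open>y\<close>, a smooth map composed with the inverse, so each
  order of smoothness of the inverse yields the next one.\<close>

lemma smooth_on_the_inv_into:
  fixes f :: "'a::euclidean_space \<Rightarrow> 'a"
  assumes S: "open S" "inj_on f S"
    and f': "\<And>x. x \<in> S \<Longrightarrow> (f has_derivative f' x) (at x)"
    and inv: "\<And>x. x \<in> S \<Longrightarrow> f' x \<circ> g' x = id"
    and g': "\<And>i. i \<in> Basis \<Longrightarrow> smooth_on S (\<lambda>x. g' x i)"
  shows "smooth_on (f ` S) (the_inv_into S f)"
proof -
  let ?g = "the_inv_into S f"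
  have g_f: "?g (f x) = x" if "x \<in> S" for x
    using S(2) that by (rule the_inv_into_f_f)
  have der: "(?g has_derivative g' (?g y)) (at y)" if "y \<in> f ` S" for y
  proof -
    from that obtain x where x: "x \<in> S" "y = f x" by auto
    show ?thesis
      unfolding x(2) g_f[OF x(1)]
      by (rule has_derivative_inverse_on[OF S(1), of f f' ?g x g']) (use x f' g_f inv in auto)
  qed
  have "Ck_on k (f ` S) ?g" for k
  proof (induction k)
    case 0
    have "continuous_on (f ` S) ?g"
      by (rule continuous_at_imp_continuous_on) (use der has_derivative_continuous in blast)
    then show ?case by simp
  next
    case (Suc k)
    have "Ck_on k (f ` S) (\<lambda>y. g' (?g y) i)" if "i \<in> Basis" for i
      by (rule Ck_on_compose[OF Suc, of S]) (use g'[OF that] g_f in \<open>auto simp: smooth_on_def\<close>)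
    with der show ?case
      by (rule Ck_on_SucI)
  qed
  then show ?thesis
    by (simp add: smooth_on_def)
qed

section \<open>The radial functions\<close>

text \<open>The equation tan s = s is treated as a zero of s cos s - sin s, which stays regular at 3
  pi/2. Its derivative -s sin s is positive between pi and 3 pi/2.\<close>

lemma tan_fixpoint_function_strict_mono:
  assumes "pi \<le> x" "x < y" "y \<le> 3/2 * pi"
  shows "x * cos x - sin x < y * cos y - sin (y::real)"
proof (rule DERIV_pos_imp_increasing_open[OF \<open>x < y\<close>])
  fix s assume s: "x < s" "s < y"
  have "0 < sin (s - pi)"
    using s assms pi_gt_zero by (intro sin_gt_zero) auto
  then have "sin s < 0"
    by simp
  moreover have "0 < s"
    using s assms pi_gt_zero by auto
  ultimately have "- (s * sin s) > 0"
    by (simp add: mult_pos_neg)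
  moreover have "((\<lambda>s. s * cos s - sin s) has_real_derivative - (s * sin s)) (at s)"
    by (auto intro!: derivative_eq_intros)
  ultimately show "\<exists>z. ((\<lambda>s. s * cos s - sin s) has_real_derivative z) (at s) \<and> 0 < z"
    by blast
qed (auto intro!: continuous_intros)

lemma cos_neg_third_quadrant:
  assumes "pi < s" "s < 3/2 * pi"
  shows "cos s < 0"
proof -
  have "0 < cos (s - pi)"
    using assms by (intro cos_gt_zero) auto
  then show ?thesis by simp
qed

lemma sin_neg_third_quadrant:
  assumes "pi < s" "s < 3/2 * pi"
  shows "sin s < 0"
proof -
  have "0 < sin (s - pi)"
    using assms by (intro sin_gt_zero) auto
  then show ?thesis by simp
qed

text \<open>The \<open>THE\<close> is justified by the intermediate value theorem (values -pi and 1
  at the ends) and by strict monotonicity.\<close>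

lemma vartheta1:
  shows pi_less_vartheta1: "pi < vartheta1"
    and vartheta1_less: "vartheta1 < 3/2 * pi"
    and vartheta1_cos_eq_sin: "vartheta1 * cos vartheta1 = sin vartheta1"
proof -
  let ?h = "\<lambda>s::real. s * cos s - sin s"
  have end_pos: "?h (3/2 * pi) = 1"
    by (simp only: cos_3over2_pi sin_3over2_pi)
  have "\<exists>s\<ge>pi. s \<le> 3/2 * pi \<and> ?h s = 0"
    by (rule IVT'[of ?h], unfold end_pos) (auto intro!: continuous_intros)
  then obtain s where s: "pi \<le> s" "s \<le> 3/2 * pi" "?h s = 0"
    by auto
  moreover have "s \<noteq> pi"
    using s(3) by auto
  moreover have "s \<noteq> 3/2 * pi"
    using s(3) end_pos by (metis zero_neq_one)
  ultimately have s': "pi < s" "s < 3/2 * pi"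
    by auto
  have iff: "tan x = x \<longleftrightarrow> ?h x = 0" if "pi < x" "x < 3/2 * pi" for x
    using cos_neg_third_quadrant[OF that] by (auto simp: tan_def field_simps)
  have uniq: "x = s" if "pi < x" "x < 3/2 * pi" "tan x = x" for x
    using tan_fixpoint_function_strict_mono[of x s] tan_fixpoint_function_strict_mono[of s x]
      that s s' iff[of x] by (cases x s rule: linorder_cases) auto
  have "vartheta1 = s"
    unfolding vartheta1_def
  proof (rule the_equality)
    show "pi < s \<and> s < 3/2 * pi \<and> tan s = s"
      using s' iff[OF s'] s(3) by blast
  qed (use uniq in blast)
  with s s' show "pi < vartheta1" "vartheta1 < 3/2 * pi" "vartheta1 * cos vartheta1 = sin vartheta1"
    by auto
qed

section \<open>Radial functions of rho = r^2 and their signs\<close>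

definition rho_interval :: "real set" where
  "rho_interval = {pi\<^sup>2<..<vartheta1\<^sup>2}"

definition qf :: "real \<Rightarrow> real" where
  "qf \<rho> = sqrt \<rho> * cot (sqrt \<rho>)"

text \<open>In terms of \<open>q = qf \<rho>\<close>, which satisfies \<open>2 \<rho> q' = q - \<rho> - q\<^sup>2\<close>, all derivatives are rational
  functions of \<open>\<rho>\<close> and \<open>q\<close>.\<close>
definition Gf :: "real \<Rightarrow> real" where
  "Gf \<rho> = (1 - qf \<rho>) / \<rho>"

definition Gf1 :: "real \<Rightarrow> real" where
  "Gf1 \<rho> = ((qf \<rho>)\<^sup>2 + qf \<rho> + \<rho> - 2) / (2 * \<rho>\<^sup>2)"

definition Gf2 :: "real \<Rightarrow> real" where
  "Gf2 \<rho> = (8 - 2 * qf \<rho> ^ 3 - 3 * (qf \<rho>)\<^sup>2 - 3 * qf \<rho> - 2 * qf \<rho> * \<rho> - 3 * \<rho>) / (4 * \<rho> ^ 3)"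

text \<open>Equal to \<open>-1/G\<close> on \<open>rho_interval\<close>, but in this form also continuous at \<open>\<pi>\<^sup>2\<close>.\<close>
definition Ef :: "real \<Rightarrow> real" where
  "Ef \<rho> = \<rho> * sin (sqrt \<rho>) / (sqrt \<rho> * cos (sqrt \<rho>) - sin (sqrt \<rho>))"

definition Ef1 :: "real \<Rightarrow> real" where
  "Ef1 \<rho> = ((qf \<rho>)\<^sup>2 + qf \<rho> + \<rho> - 2) / (2 * (qf \<rho> - 1)\<^sup>2)"

definition Ef2 :: "real \<Rightarrow> real" where
  "Ef2 \<rho> = (3 * qf \<rho> * (qf \<rho> - 1)\<^sup>2 + \<rho> * (2 * qf \<rho> + 5) * (qf \<rho> - 1) + 2 * \<rho>\<^sup>2) / (4 * \<rho> * (qf \<rho> - 1) ^ 3)"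

lemma open_rho_interval: "open rho_interval"
  by (simp add: rho_interval_def)

lemma rho_interval_bounds:
  assumes "\<rho> \<in> rho_interval"
  shows "9 < \<rho>" "\<rho> < 9/4 * pi\<^sup>2" "pi < sqrt \<rho>" "sqrt \<rho> < vartheta1" "sqrt \<rho> < 3/2 * pi"
proof -
  have "3\<^sup>2 < pi\<^sup>2"
    using pi_gt3 by (intro power_strict_mono) auto
  then show "9 < \<rho>"
    using assms by (simp add: rho_interval_def)
  have "vartheta1\<^sup>2 < (3/2 * pi)\<^sup>2"
    using vartheta1_less pi_less_vartheta1 pi_gt_zero by (intro power_strict_mono) auto
  then show "\<rho> < 9/4 * pi\<^sup>2"
    using assms by (simp add: rho_interval_def power_mult_distrib power_divide)
  show "pi < sqrt \<rho>"
    using assms by (auto simp: rho_interval_def intro: real_less_rsqrt)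
  show "sqrt \<rho> < vartheta1"
    using assms pi_less_vartheta1 pi_gt_zero
    by (intro real_less_lsqrt) (auto simp: rho_interval_def simp del: pi_gt_zero)
  then show "sqrt \<rho> < 3/2 * pi"
    using vartheta1_less by simp
qed

lemma power2_in_rho_interval:
  assumes "pi < r" "r < vartheta1"
  shows "r\<^sup>2 \<in> rho_interval"
  using assms pi_gt_zero unfolding rho_interval_def greaterThanLessThan_iff
  by (intro conjI power_strict_mono) linarith+

lemma sin_cos_sqrt_neg:
  assumes "\<rho> \<in> rho_interval"
  shows "sin (sqrt \<rho>) < 0" "cos (sqrt \<rho>) < 0" "sqrt \<rho> * cos (sqrt \<rho>) < sin (sqrt \<rho>)"
proof -
  note b = rho_interval_bounds[OF assms]
  show "sin (sqrt \<rho>) < 0" "cos (sqrt \<rho>) < 0"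
    using b sin_neg_third_quadrant cos_neg_third_quadrant by auto
  show "sqrt \<rho> * cos (sqrt \<rho>) < sin (sqrt \<rho>)"
    using tan_fixpoint_function_strict_mono[of "sqrt \<rho>" vartheta1] b vartheta1 by auto
qed

lemma qf_gt_1:
  assumes "\<rho> \<in> rho_interval"
  shows "1 < qf \<rho>"
  using sin_cos_sqrt_neg[OF assms] by (simp add: qf_def cot_def field_simps)

lemma qf_has_derivative:
  assumes "\<rho> \<in> rho_interval"
  shows "(qf has_real_derivative (qf \<rho> - \<rho> - (qf \<rho>)\<^sup>2) / (2 * \<rho>)) (at \<rho>)"
proof -
  have r: "0 < \<rho>" "0 < sqrt \<rho>" "sin (sqrt \<rho>) \<noteq> 0"
    using rho_interval_bounds[OF assms] sin_cos_sqrt_neg[OF assms] by auto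
  have "(qf has_real_derivative
      inverse (sqrt \<rho>) / 2 * cot (sqrt \<rho>) + (- inverse ((sin (sqrt \<rho>))\<^sup>2) * (inverse (sqrt \<rho>) / 2)) * sqrt \<rho>) (at \<rho>)"
    unfolding qf_def
    by (rule DERIV_mult DERIV_chain2[OF DERIV_cot] DERIV_real_sqrt r)+
  moreover have "inverse ((sin (sqrt \<rho>))\<^sup>2) = 1 + (cot (sqrt \<rho>))\<^sup>2"
    using r(3) sin_cos_squared_add[of "sqrt \<rho>"] by (simp add: cot_def field_simps)
  moreover have "inverse (sqrt \<rho>) / 2 * c + (- (1 + c\<^sup>2) * (inverse (sqrt \<rho>) / 2)) * sqrt \<rho>
      = (sqrt \<rho> * c - \<rho> - (sqrt \<rho> * c)\<^sup>2) / (2 * \<rho>)" for c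
    using r by (simp add: field_simps power_mult_distrib)
  ultimately show ?thesis
    by (simp add: qf_def)
qed

lemma Gf_has_derivative:
  assumes "\<rho> \<in> rho_interval"
  shows "(Gf has_real_derivative Gf1 \<rho>) (at \<rho>)"
proof -
  have "0 < \<rho>" using rho_interval_bounds[OF assms] by auto
  then show ?thesis
    unfolding Gf_def Gf1_def
    by (auto intro!: derivative_eq_intros qf_has_derivative[OF assms]
        simp: field_simps power2_eq_square)
qed

lemma Gf1_has_derivative:
  assumes "\<rho> \<in> rho_interval"
  shows "(Gf1 has_real_derivative Gf2 \<rho>) (at \<rho>)"
proof -
  have "0 < \<rho>" using rho_interval_bounds[OF assms] by auto
  then show ?thesis
    unfolding Gf1_def Gf2_def
    by (auto intro!: derivative_eq_intros qf_has_derivative[OF assms]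
        simp: field_simps power2_eq_square power3_eq_cube)
qed

lemma Ef1_has_derivative:
  assumes "\<rho> \<in> rho_interval"
  shows "(Ef1 has_real_derivative Ef2 \<rho>) (at \<rho>)"
proof -
  have "0 < \<rho>" using rho_interval_bounds[OF assms] by auto
  moreover have "qf \<rho> - 1 \<noteq> 0" using qf_gt_1[OF assms] by auto
  ultimately show ?thesis
    unfolding Ef1_def Ef2_def
    apply (auto intro!: derivative_eq_intros qf_has_derivative[OF assms])
    apply (simp add: divide_simps)
    apply algebra
    done
qed

lemma Ef_eq:
  assumes "\<rho> \<in> rho_interval"
  shows "Ef \<rho> = \<rho> / (qf \<rho> - 1)"
  using sin_cos_sqrt_neg[OF assms] qf_gt_1[OF assms]
  by (simp add: Ef_def qf_def cot_def divide_simps)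

lemma Ef_has_derivative:
  assumes "\<rho> \<in> rho_interval"
  shows "(Ef has_real_derivative Ef1 \<rho>) (at \<rho>)"
proof (rule has_field_derivative_transform_within_open[OF _ open_rho_interval assms Ef_eq[symmetric]])
  have "0 < \<rho>" using rho_interval_bounds[OF assms] by auto
  moreover have "qf \<rho> - 1 \<noteq> 0" using qf_gt_1[OF assms] by auto
  ultimately show "((\<lambda>\<rho>. \<rho> / (qf \<rho> - 1)) has_real_derivative Ef1 \<rho>) (at \<rho>)"
    unfolding Ef1_def
    apply (auto intro!: derivative_eq_intros qf_has_derivative[OF assms])
    apply (simp add: divide_simps)
    apply algebra
    done
qed

text \<open>All claims reduce to rational inequalities in q = \<open>qf \<rho>\<close> under q > 1
  and rho > 9. The bound 1/2 is the limiting slope of \<open>Ef\<close> at pi^2.\<close>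

lemma Ef_Gf_relations:
  assumes "\<rho> \<in> rho_interval"
  shows "0 < Ef \<rho>" "Gf \<rho> = - 1 / Ef \<rho>" "Gf1 \<rho> = Ef1 \<rho> / (Ef \<rho>)\<^sup>2" "1/2 < Ef1 \<rho>" "0 < Ef2 \<rho>"
    "Gf \<rho> < 0" "0 < Gf1 \<rho>" "Gf2 \<rho> < 0"
proof -
  define q where "q = qf \<rho>"
  have q: "1 < q" and r: "9 < \<rho>"
    using qf_gt_1[OF assms] rho_interval_bounds[OF assms] by (auto simp: q_def)
  have Ef: "Ef \<rho> = \<rho> / (q - 1)"
    using Ef_eq[OF assms] by (simp add: q_def)
  show "0 < Ef \<rho>" "Gf \<rho> = - 1 / Ef \<rho>" "Gf1 \<rho> = Ef1 \<rho> / (Ef \<rho>)\<^sup>2"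
    using q r unfolding Ef Gf_def Gf1_def Ef1_def q_def[symmetric]
    by (simp_all add: divide_simps power2_eq_square)
  have *: "(q - 1)\<^sup>2 < q\<^sup>2 + q + \<rho> - 2"
    using q r by (simp add: power2_eq_square algebra_simps)
  then show "1/2 < Ef1 \<rho>"
    using q unfolding Ef1_def q_def[symmetric] by (simp add: divide_simps)
  have "0 < 3 * q * (q - 1)\<^sup>2 + \<rho> * (2 * q + 5) * (q - 1) + 2 * \<rho>\<^sup>2"
    using q r by (intro add_pos_pos mult_pos_pos) auto
  then show "0 < Ef2 \<rho>"
    using q r unfolding Ef2_def q_def[symmetric] by (intro divide_pos_pos) auto
  show "Gf \<rho> < 0"
    using q r unfolding Gf_def q_def[symmetric] by (simp add: divide_simps)
  have "0 < q\<^sup>2 + q + \<rho> - 2"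
    using * by (smt (verit) zero_le_power2)
  then show "0 < Gf1 \<rho>"
    using r unfolding Gf1_def q_def[symmetric] by simp
  have "1 < q\<^sup>2" "1 < q ^ 3"
    using q by (auto intro: one_less_power)
  moreover have "0 < q * \<rho>" using q r by simp
  ultimately have "8 - 2 * q ^ 3 - 3 * q\<^sup>2 - 3 * q - 2 * q * \<rho> - 3 * \<rho> < 0"
    using q r by (simp only: mult.assoc)
  then show "Gf2 \<rho> < 0"
    using r unfolding Gf2_def q_def[symmetric] by (simp add: divide_neg_pos)
qed

lemma Ef_at_pi: "Ef (pi\<^sup>2) = 0"
  by (simp add: Ef_def)

lemma Ef_continuous_at_pi: "isCont Ef (pi\<^sup>2)"
  unfolding Ef_def by (auto intro!: continuous_intros)

lemma rho_interval_downward: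
  assumes "y \<in> rho_interval" "pi\<^sup>2 < x" "x \<le> y"
  shows "x \<in> rho_interval"
  using assms by (auto simp: rho_interval_def)

lemma Ef1_strict_mono:
  assumes "x \<in> rho_interval" "y \<in> rho_interval" "x < y"
  shows "Ef1 x < Ef1 y"
proof (rule DERIV_pos_imp_increasing[OF \<open>x < y\<close>])
  fix s assume "x \<le> s" "s \<le> y"
  then have "s \<in> rho_interval"
    using assms by (auto simp: rho_interval_def)
  then show "\<exists>z. (Ef1 has_real_derivative z) (at s) \<and> 0 < z"
    using Ef1_has_derivative Ef_Gf_relations(5) by blast
qed

lemma Ef_strict_mono:
  assumes "x \<in> rho_interval" "y \<in> rho_interval" "x < y"
  shows "Ef x < Ef y"
proof (rule DERIV_pos_imp_increasing[OF \<open>x < y\<close>])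
  fix s assume "x \<le> s" "s \<le> y"
  then have "s \<in> rho_interval"
    using assms by (auto simp: rho_interval_def)
  then show "\<exists>z. (Ef has_real_derivative z) (at s) \<and> 0 < z"
    using Ef_has_derivative Ef_Gf_relations(4) by (smt (verit) divide_pos_pos)
qed

text \<open>Convexity of \<^term>\<open>Ef\<close> together with its zero at \<open>\<pi>\<^sup>2\<close>.\<close>
lemma Ef_less_tangent:
  assumes "\<rho> \<in> rho_interval"
  shows "Ef \<rho> < Ef1 \<rho> * (\<rho> - pi\<^sup>2)"
proof -
  have lt: "pi\<^sup>2 < \<rho>"
    using assms by (simp add: rho_interval_def)
  have I: "s \<in> rho_interval" if "pi\<^sup>2 < s" "s \<le> \<rho>" for s
    using rho_interval_downward[OF assms that] .
  have "continuous_on {pi\<^sup>2..\<rho>} Ef"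
  proof (intro continuous_at_imp_continuous_on ballI)
    fix s assume "s \<in> {pi\<^sup>2..\<rho>}"
    then show "isCont Ef s"
      using Ef_continuous_at_pi I[of s] DERIV_isCont[OF Ef_has_derivative, of s]
      by (cases "s = pi\<^sup>2") auto
  qed
  then obtain l z where z: "pi\<^sup>2 < z" "z < \<rho>" "(Ef has_real_derivative l) (at z)"
      "Ef \<rho> - Ef (pi\<^sup>2) = (\<rho> - pi\<^sup>2) * l"
    using MVT[OF lt, of Ef] I Ef_has_derivative real_differentiable_def
    by (metis less_imp_le)
  have l: "l = Ef1 z"
    using z I Ef_has_derivative DERIV_unique by (metis less_imp_le)
  have "Ef1 z < Ef1 \<rho>"
    using z I assms by (intro Ef1_strict_mono) auto
  then show ?thesis
    using z lt by (simp add: l Ef_at_pi mult.commute mult_strict_left_mono)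
qed

section \<open>Sign of the Jacobian determinant in the variables rho and w\<close>

lemma Lambda_jacobian_neg:
  assumes \<rho>: "\<rho> \<in> rho_interval" and w: "0 < w" and K: "Gf \<rho> + Gf1 \<rho> * w < 0"
  shows "Gf1 \<rho> * Gf \<rho> + 9 * (Gf1 \<rho>)\<^sup>2 * w + 2 * \<rho> * (Gf2 \<rho> * Gf \<rho> - 2 * (Gf1 \<rho>)\<^sup>2)
    + 2 * w * Gf2 \<rho> * (\<rho> * Gf1 \<rho> - Gf \<rho>) < 0"
proof -
  note r = Ef_Gf_relations[OF \<rho>] 
  define q where "q = qf \<rho>"
  have q: "1 < q" and r9: "9 < \<rho>"
    using qf_gt_1[OF \<rho>] rho_interval_bounds[OF \<rho>] by (auto simp: q_def)
  \<comment> \<open>\<open>f\<close> is affine, so its endpoints \<open>0\<close> and \<open>W\<close> suffice.\<close>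
  define f where "f w = Gf1 \<rho> * Gf \<rho> + 9 * (Gf1 \<rho>)\<^sup>2 * w + 2 * \<rho> * (Gf2 \<rho> * Gf \<rho> - 2 * (Gf1 \<rho>)\<^sup>2)
    + 2 * w * Gf2 \<rho> * (\<rho> * Gf1 \<rho> - Gf \<rho>)" for w
  \<comment> \<open>The value of w at which K3 vanishes; the hypothesis \<open>K\<close> puts w
    strictly below it.\<close>
  define W where "W = - Gf \<rho> / Gf1 \<rho>"
  have W: "w < W"
    using K r(7) by (simp add: W_def field_simps)
  \<comment> \<open>Differentiating E = -1/G twice gives E'' G^3 = G'' G - 2 G'^2, so convexity of E
    settles the sign at w = 0.\<close>
  have "Gf2 \<rho> * Gf \<rho> - 2 * (Gf1 \<rho>)\<^sup>2 = Ef2 \<rho> * Gf \<rho> ^ 3"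
    unfolding Gf_def Gf1_def Gf2_def Ef2_def q_def[symmetric]
    using q r9 apply (simp add: divide_simps) apply algebra done
  moreover have "Ef2 \<rho> * Gf \<rho> ^ 3 < 0"
    using r by (simp add: mult_pos_neg power_less_zero_eq)
  ultimately have "2 * \<rho> * (Gf2 \<rho> * Gf \<rho> - 2 * (Gf1 \<rho>)\<^sup>2) < 0"
    using r9 by (simp add: mult_pos_neg)
  moreover have "Gf1 \<rho> * Gf \<rho> < 0"
    using r(6,7) by (simp add: mult_pos_neg)
  ultimately have "f 0 < 0"
    unfolding f_def by simp
  moreover have "f W < 0"
  proof -
    \<comment> \<open>Completing the square in q leaves rho - 1/4, positive since rho > 9.\<close>
    have "2 * Gf \<rho> + \<rho> * Gf1 \<rho> = ((q - 3/2)\<^sup>2 + (\<rho> - 1/4)) / (2 * \<rho>)"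
      unfolding Gf_def Gf1_def q_def[symmetric] using r9
      by (simp add: field_simps power2_eq_square)
    then have "0 < 2 * Gf \<rho> + \<rho> * Gf1 \<rho>"
      using r9 by (simp add: add_nonneg_pos)
    then have "0 < 2 * (Gf1 \<rho>)\<^sup>2 * (2 * Gf \<rho> + \<rho> * Gf1 \<rho>)"
      using r by simp
    moreover have "(Gf \<rho>)\<^sup>2 * Gf2 \<rho> < 0"
      using r by (simp add: mult_pos_neg)
    ultimately have "(Gf \<rho>)\<^sup>2 * Gf2 \<rho> < 2 * (Gf1 \<rho>)\<^sup>2 * (2 * Gf \<rho> + \<rho> * Gf1 \<rho>)"
      by (rule less_trans[rotated])
    then have "2 * ((Gf \<rho>)\<^sup>2 * Gf2 \<rho> - 2 * (Gf1 \<rho>)\<^sup>2 * (2 * Gf \<rho> + \<rho> * Gf1 \<rho>)) < 0"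
      by (simp add: mult_ac)
    moreover have "f W * Gf1 \<rho> = 2 * ((Gf \<rho>)\<^sup>2 * Gf2 \<rho> - 2 * (Gf1 \<rho>)\<^sup>2 * (2 * Gf \<rho> + \<rho> * Gf1 \<rho>))"
      unfolding f_def W_def using r(7) by (simp add: field_simps power2_eq_square)
    ultimately have "f W * Gf1 \<rho> < 0"
      by (simp only:)
    then show ?thesis
      using r(7) by (simp add: mult_less_0_iff)
  qed
  moreover have "f w = (1 - w / W) * f 0 + (w / W) * f W"
    using w W unfolding f_def by (simp add: field_simps)
  moreover have "0 < w / W" "0 < 1 - w / W"
    using w W by auto
  ultimately have "f w < 0"
    by (smt (verit) mult_pos_neg)
  then show ?thesis
    by (simp add: f_def)
qed

section \<open>Monotonicity of u_1 in the coordinates (rho, m)\<close>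

text \<open>The sign condition says w <= E/E', and the tangent bound gives E/E' < rho - pi^2. With
  rho = |v|^2 and w = v_2^2 the conclusion reads v_1^2 > pi^2.\<close>

lemma K3_bound_imp_w_bound:
  assumes \<rho>: "\<rho> \<in> rho_interval" and K: "Gf \<rho> + Gf1 \<rho> * w \<le> 0"
  shows "w < \<rho> - pi\<^sup>2"
proof -
  note r = Ef_Gf_relations[OF \<rho>]
  have "w * Ef1 \<rho> \<le> Ef \<rho>"
    using K r(1) unfolding r(2,3) by (simp add: divide_simps power2_eq_square algebra_simps)
  also have "\<dots> < (\<rho> - pi\<^sup>2) * Ef1 \<rho>"
    using Ef_less_tangent[OF \<rho>] by (simp add: mult.commute)
  finally show ?thesis
    using r(4) by (simp add: mult_less_cancel_right)
qed

text \<open>In the coordinate m = w/E^2 negativity of K3 becomes m E E' < 1, the form in which the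
  constraint is used below.\<close>

lemma m_bound_imp_w_bound:
  assumes \<rho>: "\<rho> \<in> rho_interval" and K: "m * (Ef \<rho> * Ef1 \<rho>) < 1"
  shows "m * (Ef \<rho>)\<^sup>2 < \<rho> - pi\<^sup>2"
proof (rule K3_bound_imp_w_bound[OF \<rho>])
  note r = Ef_Gf_relations[OF \<rho>]
  show "Gf \<rho> + Gf1 \<rho> * (m * (Ef \<rho>)\<^sup>2) \<le> 0"
    using K r(1) unfolding r(2,3) by (simp add: divide_simps power2_eq_square algebra_simps)
qed

text \<open>The cubic x^2 (rho - e x) has derivative x (2 rho - 3 e x), positive up to the bound;
  the proof extracts the factor y - x instead of differentiating.\<close>

lemma square_times_linear_strict_mono:
  fixes x y e \<rho> :: real
  assumes "0 < x" "x < y" "0 < e" "3 * (y * e) < 2 * \<rho>"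
  shows "x\<^sup>2 * (\<rho> - x * e) < y\<^sup>2 * (\<rho> - y * e)"
proof -
  have "x * x < x * y" "x * y < y * y"
    using assms by auto
  then have "y\<^sup>2 + x * y + x\<^sup>2 < 3/2 * y * (y + x)"
    by (simp add: power2_eq_square algebra_simps)
  then have "e * (y\<^sup>2 + x * y + x\<^sup>2) < e * (3/2 * y * (y + x))"
    using assms(3) by (intro mult_strict_left_mono)
  also have "\<dots> = (3 * (y * e)) * ((y + x) / 2)"
    by (simp add: algebra_simps)
  also have "\<dots> < 2 * \<rho> * ((y + x) / 2)"
    using assms by (intro mult_strict_right_mono) auto
  finally have "0 < (y - x) * ((y + x) * \<rho> - e * (y\<^sup>2 + x * y + x\<^sup>2))"
    using assms by (intro mult_pos_pos) (auto simp: algebra_simps)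
  then show ?thesis
    by (simp add: algebra_simps power2_eq_square)
qed

text \<open>Since u_1 = 2 m E' v_1 and v_1^2 = rho - m E^2, the expression is u_1^2 / 4; here it
  grows with m at fixed rho.\<close>

lemma u1_square_strict_mono_m:
  assumes \<rho>: "\<rho> \<in> rho_interval" and m: "0 < m" "m < m'" and K: "m' * (Ef \<rho> * Ef1 \<rho>) < 1"
  shows "(m * Ef1 \<rho>)\<^sup>2 * (\<rho> - m * (Ef \<rho>)\<^sup>2) < (m' * Ef1 \<rho>)\<^sup>2 * (\<rho> - m' * (Ef \<rho>)\<^sup>2)"
proof -
  note r = Ef_Gf_relations[OF \<rho>]
  \<comment> \<open>With w = m' E^2, the bounds w < rho - pi^2 and rho < 9/4 pi^2 give 3 w < 2
    rho.\<close>
  have "3 * (m' * (Ef \<rho>)\<^sup>2) < 2 * \<rho>"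
    using m_bound_imp_w_bound[OF \<rho> K] rho_interval_bounds(1,2)[OF \<rho>] by simp
  then have "m\<^sup>2 * (\<rho> - m * (Ef \<rho>)\<^sup>2) < m'\<^sup>2 * (\<rho> - m' * (Ef \<rho>)\<^sup>2)"
    using m r(1) by (intro square_times_linear_strict_mono) auto
  then have "(Ef1 \<rho>)\<^sup>2 * (m\<^sup>2 * (\<rho> - m * (Ef \<rho>)\<^sup>2)) < (Ef1 \<rho>)\<^sup>2 * (m'\<^sup>2 * (\<rho> - m' * (Ef \<rho>)\<^sup>2))"
    using r(4) by (intro mult_strict_left_mono) auto
  then show ?thesis
    by (simp add: power_mult_distrib mult_ac)
qed

text \<open>Needed for the rho-derivative of u_1^2. In s = q - 1 it becomes a polynomial inequality,
  where the bounds 9 < rho < 9/4 pi^2 let the right side dominate each term on the left.\<close>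

lemma Ef1_less_pi_Ef2:
  assumes \<rho>: "\<rho> \<in> rho_interval"
  shows "Ef1 \<rho> < 2 * Ef2 \<rho> * pi\<^sup>2"
proof -
  define s where "s = qf \<rho> - 1"
  have s: "0 < s" and q: "qf \<rho> = s + 1" and r9: "9 < \<rho>" and r: "\<rho> < 9/4 * pi\<^sup>2"
    using qf_gt_1[OF \<rho>] rho_interval_bounds[OF \<rho>] by (auto simp: s_def)
  have "\<rho> * s ^ 3 \<le> 9/4 * pi\<^sup>2 * s ^ 3" "\<rho> * s\<^sup>2 \<le> 9/4 * pi\<^sup>2 * s\<^sup>2" "\<rho> * (\<rho> * s) \<le> 9/4 * pi\<^sup>2 * (\<rho> * s)"
    using s r r9 by (auto intro!: mult_right_mono simp del: mult_le_cancel_left)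
  moreover have "0 < pi\<^sup>2 * s ^ 3" "0 < pi\<^sup>2 * s\<^sup>2" "0 < pi\<^sup>2 * (\<rho> * s)" "0 < pi\<^sup>2 * \<rho>\<^sup>2"
    using s r9 by simp_all
  moreover have "9 * (pi\<^sup>2 * s\<^sup>2) < \<rho> * (pi\<^sup>2 * s\<^sup>2)"
    using s r9 by (intro mult_strict_right_mono) auto
  ultimately have "\<rho> * s ^ 3 + 3 * (\<rho> * s\<^sup>2) + \<rho> * (\<rho> * s)
      < 3 * (pi\<^sup>2 * s ^ 3) + 3 * (pi\<^sup>2 * s\<^sup>2) + 2 * (\<rho> * (pi\<^sup>2 * s\<^sup>2)) + 7 * (pi\<^sup>2 * (\<rho> * s)) + 2 * (pi\<^sup>2 * \<rho>\<^sup>2)"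
    by linarith
  then have "\<rho> * s * (s * s + 3 * s + \<rho>)
      < pi\<^sup>2 * (3 * (s + 1) * s\<^sup>2 + \<rho> * (2 * s + 7) * s + 2 * \<rho>\<^sup>2)"
    by (simp add: algebra_simps power2_eq_square power3_eq_cube)
  then show ?thesis
    unfolding Ef1_def Ef2_def q using s r9
    by (simp add: divide_simps power2_eq_square power3_eq_cube) (simp add: algebra_simps)
qed

text \<open>Growth of u_1^2 / 4 in rho at fixed m. The constraint at the right end \<open>y\<close>
  passes to all smaller rho because E E' increases.\<close>

lemma u1_square_strict_mono_rho:
  assumes \<rho>: "x \<in> rho_interval" "y \<in> rho_interval" "x < y"
    and m: "0 < m" and K: "m * (Ef y * Ef1 y) < 1"
  shows "(m * Ef1 x)\<^sup>2 * (x - m * (Ef x)\<^sup>2) < (m * Ef1 y)\<^sup>2 * (y - m * (Ef y)\<^sup>2)"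
proof (rule DERIV_pos_imp_increasing[OF \<open>x < y\<close>])
  fix s assume sxy: "x \<le> s" "s \<le> y"
  then have s: "s \<in> rho_interval"
    using \<rho> by (auto simp: rho_interval_def)
  note r = Ef_Gf_relations[OF s] and ry = Ef_Gf_relations[OF \<rho>(2)]
  have "Ef s \<le> Ef y" "Ef1 s \<le> Ef1 y"
    using Ef_strict_mono[OF s \<rho>(2)] Ef1_strict_mono[OF s \<rho>(2)] sxy by (cases "s = y"; auto)+
  then have "Ef s * Ef1 s \<le> Ef y * Ef1 y"
    using r ry by (intro mult_mono) auto
  then have "m * (Ef s * Ef1 s) \<le> m * (Ef y * Ef1 y)"
    using m by simp
  with K have Ks: "m * (Ef s * Ef1 s) < 1"
    by simp
  \<comment> \<open>The derivative is m^2 E' D. The first summand of D exceeds 2 E'' pi^2 > E', the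
    second exceeds -E'.\<close>
  define D where "D = 2 * Ef2 s * (s - m * (Ef s)\<^sup>2) + Ef1 s * (1 - 2 * (m * (Ef s * Ef1 s)))"
  have "2 * Ef2 s * pi\<^sup>2 < 2 * Ef2 s * (s - m * (Ef s)\<^sup>2)"
    using m_bound_imp_w_bound[OF s Ks] r by simp
  moreover have "Ef1 s * (- 1) < Ef1 s * (1 - 2 * (m * (Ef s * Ef1 s)))"
    using Ks r(4) by (intro mult_strict_left_mono) auto
  ultimately have "0 < D"
    using Ef1_less_pi_Ef2[OF s] by (simp add: D_def)
  then have "0 < m\<^sup>2 * Ef1 s * D"
    using m r by simp
  moreover have "((\<lambda>s. (m * Ef1 s)\<^sup>2 * (s - m * (Ef s)\<^sup>2)) has_real_derivative m\<^sup>2 * Ef1 s * D) (at s)"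
    unfolding D_def
    by (auto intro!: derivative_eq_intros Ef_has_derivative[OF s] Ef1_has_derivative[OF s]
        simp: algebra_simps power2_eq_square)
  ultimately show "\<exists>z. ((\<lambda>s. (m * Ef1 s)\<^sup>2 * (s - m * (Ef s)\<^sup>2)) has_real_derivative z) (at s) \<and> 0 < z"
    by blast
qed

text \<open>With y = w/rho one has (G' w)^2 (rho - w) = G'^2 rho^3 y^2 (1 - y). As the weight G'^2
  rho^3 falls with rho, a fixed u_1 forces y to rise, given y < 2/3.\<close>

lemma Gf1_weighted_strict_antimono:
  assumes \<rho>: "x \<in> rho_interval" "y \<in> rho_interval" "x < y"
  shows "(Gf1 y)\<^sup>2 * y ^ 3 < (Gf1 x)\<^sup>2 * x ^ 3"
proof (rule DERIV_neg_imp_decreasing[OF \<open>x < y\<close>])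
  fix s assume "x \<le> s" "s \<le> y"
  then have s: "s \<in> rho_interval"
    using \<rho> by (auto simp: rho_interval_def)
  note r = Ef_Gf_relations[OF s] and q = qf_gt_1[OF s] and r9 = rho_interval_bounds(1)[OF s]
  have "2 * Gf2 s * s + 3 * Gf1 s = (1 - qf s ^ 3 - qf s * s) / s\<^sup>2"
    unfolding Gf1_def Gf2_def using r9
    apply (simp add: divide_simps)
    apply algebra
    done
  moreover have "1 - qf s ^ 3 - qf s * s < 0"
    using one_less_power[OF q, of 3] mult_pos_pos[of "qf s" s] q r9 by linarith
  ultimately have "2 * Gf2 s * s + 3 * Gf1 s < 0"
    using r9 by (simp add: divide_neg_pos)
  then have "Gf1 s * s\<^sup>2 * (2 * Gf2 s * s + 3 * Gf1 s) < 0"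
    using r(7) r9 by (simp add: mult_pos_neg)
  moreover have "((\<lambda>s. (Gf1 s)\<^sup>2 * s ^ 3) has_real_derivative Gf1 s * s\<^sup>2 * (2 * Gf2 s * s + 3 * Gf1 s)) (at s)"
    by (auto intro!: derivative_eq_intros Gf1_has_derivative[OF s]
        simp: algebra_simps power2_eq_square power3_eq_cube)
  ultimately show "\<exists>z. ((\<lambda>s. (Gf1 s)\<^sup>2 * s ^ 3) has_real_derivative z) (at s) \<and> z < 0"
    by blast
qed

section \<open>Injectivity in the radial coordinates\<close>

text \<open>On the constrained region u_1 increases in both rho and m, so on a level set a larger
  rho comes with a smaller m.\<close>

lemma u1_determines_m:
  assumes \<rho>: "\<rho> \<in> rho_interval" "\<rho>' \<in> rho_interval" "\<rho> \<le> \<rho>'"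
    and m: "0 < m" "0 < m'" and K: "m * (Ef \<rho> * Ef1 \<rho>) < 1" "m' * (Ef \<rho>' * Ef1 \<rho>') < 1"
    and eq: "(m * Ef1 \<rho>)\<^sup>2 * (\<rho> - m * (Ef \<rho>)\<^sup>2) = (m' * Ef1 \<rho>')\<^sup>2 * (\<rho>' - m' * (Ef \<rho>')\<^sup>2)"
  shows "\<rho> = \<rho>' \<and> m = m' \<or> \<rho> < \<rho>' \<and> m' < m"
proof (cases "\<rho> = \<rho>'")
  case True
  then show ?thesis
    using u1_square_strict_mono_m[OF \<rho>(1), of m m'] u1_square_strict_mono_m[OF \<rho>(1), of m' m] m K eq
    by (cases m m' rule: linorder_cases) auto
next
  case False
  with \<rho> have lt: "\<rho> < \<rho>'" by simp
  have "m' < m"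
  proof (rule ccontr)
    assume "\<not> m' < m"
    then have le: "m \<le> m'" by simp
    note r = Ef_Gf_relations[OF \<rho>(1)]
    have "Ef \<rho> * Ef1 \<rho> < Ef \<rho>' * Ef1 \<rho>'"
      using r Ef_strict_mono[OF \<rho>(1,2) lt] Ef1_strict_mono[OF \<rho>(1,2) lt]
      by (intro mult_strict_mono) auto
    \<comment> \<open>The comparison goes from (rho, m) to (rho', m') through (rho, m'); the
      constraint holds at this corner because E E' is smaller at rho than at rho'.\<close>
    then have K': "m' * (Ef \<rho> * Ef1 \<rho>) < 1"
      using K(2) less_trans[OF mult_strict_left_mono[OF _ m(2)]] by blast
    have "(m * Ef1 \<rho>)\<^sup>2 * (\<rho> - m * (Ef \<rho>)\<^sup>2) \<le> (m' * Ef1 \<rho>)\<^sup>2 * (\<rho> - m' * (Ef \<rho>)\<^sup>2)"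
      using u1_square_strict_mono_m[OF \<rho>(1) m(1) _ K'] le by (cases "m = m'") auto
    also have "\<dots> < (m' * Ef1 \<rho>')\<^sup>2 * (\<rho>' - m' * (Ef \<rho>')\<^sup>2)"
      by (rule u1_square_strict_mono_rho[OF \<rho>(1,2) lt m(2) K(2)])
    finally show False
      using eq by simp
  qed
  with lt show ?thesis by simp
qed

text \<open>\<open>eq1\<close> and \<open>eq2\<close> are equality of u_1 / 2 and of -u_2 / 2. If
  rho < rho', then m decreases and w/rho increases, which is incompatible with equal u_2.\<close>

lemma u_determines_rho_w_aux:
  assumes \<rho>: "\<rho> \<in> rho_interval" "\<rho>' \<in> rho_interval" "\<rho> \<le> \<rho>'"
    and w: "0 < w" "0 < w'" and K: "Gf \<rho> + Gf1 \<rho> * w < 0" "Gf \<rho>' + Gf1 \<rho>' * w' < 0"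
    and eq1: "Gf1 \<rho> * w * sqrt (\<rho> - w) = Gf1 \<rho>' * w' * sqrt (\<rho>' - w')"
    and eq2: "sqrt w * (Gf \<rho> + Gf1 \<rho> * w) = sqrt w' * (Gf \<rho>' + Gf1 \<rho>' * w')"
  shows "\<rho> = \<rho>' \<and> w = w'"
proof -
  note r = Ef_Gf_relations[OF \<rho>(1)] and r' = Ef_Gf_relations[OF \<rho>(2)]
  note b = rho_interval_bounds[OF \<rho>(1)] and b' = rho_interval_bounds[OF \<rho>(2)]
  define m where "m = w / (Ef \<rho>)\<^sup>2"
  define m' where "m' = w' / (Ef \<rho>')\<^sup>2"
  have w_m: "w = m * (Ef \<rho>)\<^sup>2" "w' = m' * (Ef \<rho>')\<^sup>2"
    using r(1) r'(1) by (auto simp: m_def m'_def)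
  have m0: "0 < m" "0 < m'"
    using w r(1) r'(1) by (auto simp: m_def m'_def)
  have K_m: "m * (Ef \<rho> * Ef1 \<rho>) < 1" "m' * (Ef \<rho>' * Ef1 \<rho>') < 1"
    using K r(1) r'(1) unfolding r(2,3) r'(2,3) w_m
    by (auto simp add: divide_simps power2_eq_square algebra_simps)
  have wb: "w < \<rho> - pi\<^sup>2" "w' < \<rho>' - pi\<^sup>2"
    using K3_bound_imp_w_bound \<rho> K by (auto intro: less_imp_le)
  have pos: "0 < \<rho> - w" "0 < \<rho>' - w'"
    using wb pi_gt_zero by (smt (verit) zero_le_power2)+
  have eq1sq: "(Gf1 \<rho> * w)\<^sup>2 * (\<rho> - w) = (Gf1 \<rho>' * w')\<^sup>2 * (\<rho>' - w')"
    using arg_cong[OF eq1, of "\<lambda>x. x\<^sup>2"] pos by (simp add: power_mult_distrib)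
  have "(m * Ef1 \<rho>)\<^sup>2 * (\<rho> - m * (Ef \<rho>)\<^sup>2) = (m' * Ef1 \<rho>')\<^sup>2 * (\<rho>' - m' * (Ef \<rho>')\<^sup>2)"
    using eq1sq r(1) r'(1) unfolding r(3) r'(3) w_m by (simp add: mult.commute)
  from u1_determines_m[OF \<rho> m0 K_m this] show ?thesis
  proof
    assume "\<rho> = \<rho>' \<and> m = m'"
    then show ?thesis by (simp add: w_m)
  next
    assume lt: "\<rho> < \<rho>' \<and> m' < m"
    define y where "y = w / \<rho>"
    define y' where "y' = w' / \<rho>'"
    have wy: "w = \<rho> * y" "w' = \<rho>' * y'"
      using b b' by (auto simp: y_def y'_def)
    have y0: "0 < y" "0 < y'"
      using w b b' by (auto simp: y_def y'_def)
    have "3 * w < 2 * \<rho>" "3 * w' < 2 * \<rho>'"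
      using wb b b' by simp_all
    then have y23: "3 * y < 2" "3 * y' < 2"
      using b b' by (auto simp: y_def y'_def field_simps)
    have eqy: "((Gf1 \<rho>)\<^sup>2 * \<rho> ^ 3) * (y\<^sup>2 * (1 - y)) = ((Gf1 \<rho>')\<^sup>2 * \<rho>' ^ 3) * (y'\<^sup>2 * (1 - y'))"
      using eq1sq unfolding wy by (simp add: algebra_simps power2_eq_square power3_eq_cube)
    have "y < y'"
    proof (rule ccontr)
      assume "\<not> y < y'"
      then have "y'\<^sup>2 * (1 - y') \<le> y\<^sup>2 * (1 - y)"
        using square_times_linear_strict_mono[of y' y 1 1] y0 y23 by (cases "y = y'") auto
      moreover have "0 < y'\<^sup>2 * (1 - y')"
        using y0 y23 by simp
      ultimately have "((Gf1 \<rho>')\<^sup>2 * \<rho>' ^ 3) * (y'\<^sup>2 * (1 - y')) < ((Gf1 \<rho>)\<^sup>2 * \<rho> ^ 3) * (y\<^sup>2 * (1 - y))"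
        using r'(7) b'(1) lt
        by (intro mult_less_le_imp_less[OF Gf1_weighted_strict_antimono[OF \<rho>(1,2)]]) auto
      with eqy show False by simp
    qed
    then have "y / (1 - y) < y' / (1 - y')"
      using y23 by (simp add: divide_simps algebra_simps)
    moreover have "w / (\<rho> - w) = y / (1 - y)" "w' / (\<rho>' - w') = y' / (1 - y')"
      using b(1) b'(1) pos y23 unfolding wy by (auto simp: field_simps)
    ultimately have ratio: "w / (\<rho> - w) < w' / (\<rho>' - w')"
      by simp
    \<comment> \<open>Rearranged: u_2 / 2 = sqrt m - (u_1 / 2) sqrt (w / (rho - w)), so with u_1
      fixed both changes lower u_2.\<close>
    have split: "sqrt (w / E\<^sup>2) + sqrt w * (- 1 / E + G * w) = G * w * sqrt (\<rho> - w) * sqrt (w / (\<rho> - w))"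
      if "0 < \<rho> - w" "0 < E" for E G w \<rho> :: real
      using that by (simp add: real_sqrt_divide algebra_simps)
    have "sqrt m + sqrt w * (Gf \<rho> + Gf1 \<rho> * w) = Gf1 \<rho> * w * sqrt (\<rho> - w) * sqrt (w / (\<rho> - w))"
      using split[OF pos(1) r(1), of "Gf1 \<rho>"] by (simp add: r(2) m_def)
    moreover have "sqrt m' + sqrt w' * (Gf \<rho>' + Gf1 \<rho>' * w') = Gf1 \<rho>' * w' * sqrt (\<rho>' - w') * sqrt (w' / (\<rho>' - w'))"
      using split[OF pos(2) r'(1), of "Gf1 \<rho>'"] by (simp add: r'(2) m'_def)
    moreover have "Gf1 \<rho> * w * sqrt (\<rho> - w) * sqrt (w / (\<rho> - w)) < Gf1 \<rho> * w * sqrt (\<rho> - w) * sqrt (w' / (\<rho>' - w'))"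
      using ratio r w pos by (intro mult_strict_left_mono) auto
    moreover have "sqrt m' < sqrt m"
      using lt by simp
    ultimately show ?thesis
      using eq1 eq2 by simp
  qed
qed

lemma u_determines_rho_w:
  assumes "\<rho> \<in> rho_interval" "\<rho>' \<in> rho_interval"
    and "0 < w" "0 < w'" and "Gf \<rho> + Gf1 \<rho> * w < 0" "Gf \<rho>' + Gf1 \<rho>' * w' < 0"
    and "Gf1 \<rho> * w * sqrt (\<rho> - w) = Gf1 \<rho>' * w' * sqrt (\<rho>' - w')"
    and "sqrt w * (Gf \<rho> + Gf1 \<rho> * w) = sqrt w' * (Gf \<rho>' + Gf1 \<rho>' * w')"
  shows "\<rho> = \<rho>' \<and> w = w'"
  using u_determines_rho_w_aux[of \<rho> \<rho>' w w'] u_determines_rho_w_aux[of \<rho>' \<rho> w' w] assms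
  by (cases "\<rho> \<le> \<rho>'") auto

section \<open>Limits at the two ends of the radial interval\<close>

text \<open>\<open>Ef1\<close> is built from \<open>cot\<close>, singular at pi. Clearing sin^2 from
  numerator and denominator gives an expression continuous at pi^2.\<close>

lemma Ef1_eq:
  assumes "\<rho> \<in> rho_interval"
  shows "Ef1 \<rho> = (\<rho> * (cos (sqrt \<rho>))\<^sup>2 + sqrt \<rho> * cos (sqrt \<rho>) * sin (sqrt \<rho>) + (\<rho> - 2) * (sin (sqrt \<rho>))\<^sup>2)
    / (2 * (sqrt \<rho> * cos (sqrt \<rho>) - sin (sqrt \<rho>))\<^sup>2)"
proof -
  define r s c where "r = sqrt \<rho>" and "s = sin r" and "c = cos r"
  have "s \<noteq> 0" "r * c - s \<noteq> 0" and r: "\<rho> = r\<^sup>2"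
    using sin_cos_sqrt_neg[OF assms] rho_interval_bounds(1)[OF assms] by (auto simp: r_def s_def c_def)
  moreover from this have "r * (c / s) - 1 \<noteq> 0"
    by (simp add: field_simps)
  ultimately show ?thesis
    unfolding Ef1_def qf_def cot_def r_def[symmetric] s_def[symmetric] c_def[symmetric]
    by (simp add: divide_simps power2_eq_square) (simp add: algebra_simps)
qed

text \<open>Stated as a one-sided limit: at pi^2 itself \<open>cot\<close> takes its default value 0
  and \<open>Ef1\<close> has a different value.\<close>

lemma Ef1_tendsto_at_pi: "(Ef1 \<longlongrightarrow> 1/2) (at (pi\<^sup>2) within rho_interval)"
proof -
  define f where "f \<rho> = (\<rho> * (cos (sqrt \<rho>))\<^sup>2 + sqrt \<rho> * cos (sqrt \<rho>) * sin (sqrt \<rho>) + (\<rho> - 2) * (sin (sqrt \<rho>))\<^sup>2)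
    / (2 * (sqrt \<rho> * cos (sqrt \<rho>) - sin (sqrt \<rho>))\<^sup>2)" for \<rho> :: real
  have "isCont f (pi\<^sup>2)"
    unfolding f_def by (auto intro!: continuous_intros)
  then have "(f \<longlongrightarrow> f (pi\<^sup>2)) (at (pi\<^sup>2) within rho_interval)"
    using continuous_at_imp_continuous_at_within continuous_within by blast
  moreover have "f (pi\<^sup>2) = 1/2"
    by (simp add: f_def)
  moreover have "\<forall>\<^sub>F \<rho> in at (pi\<^sup>2) within rho_interval. f \<rho> = Ef1 \<rho>"
    unfolding eventually_at_filter using Ef1_eq by (simp add: f_def)
  ultimately show ?thesis
    using tendsto_cong by force
qed

lemma Ef_tendsto_at_pi: "(Ef \<longlongrightarrow> 0) (at (pi\<^sup>2) within rho_interval)"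
  using continuous_at_imp_continuous_at_within[OF Ef_continuous_at_pi, of rho_interval]
  unfolding continuous_within Ef_at_pi .

text \<open>The equation for \<open>vartheta1\<close> says
  \<open>qf (vartheta1\<^sup>2) = 1\<close>, which is a zero of \<open>Gf\<close>.\<close>

lemma Gf_tendsto_at_vartheta1: "(Gf \<longlongrightarrow> 0) (at (vartheta1\<^sup>2))"
proof -
  have th: "0 < vartheta1" "sqrt (vartheta1\<^sup>2) = vartheta1"
    using less_trans[OF pi_gt_zero pi_less_vartheta1] by auto
  have s: "sin vartheta1 \<noteq> 0"
    using sin_neg_third_quadrant[OF pi_less_vartheta1 vartheta1_less] by simp
  have "isCont Gf (vartheta1\<^sup>2)"
    unfolding Gf_def qf_def cot_def using th s by (auto intro!: continuous_intros)
  moreover have "Gf (vartheta1\<^sup>2) = 0"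
    using vartheta1_cos_eq_sin s th by (simp add: Gf_def qf_def cot_def)
  ultimately show ?thesis
    by (metis isCont_def)
qed

section \<open>Passage from \<open>psi\<close> to \<open>Gf\<close>\<close>

lemma psi_eq_Gf: "0 < r \<Longrightarrow> psi r = Gf (r\<^sup>2)"
  by (simp add: psi_def Gf_def qf_def)

lemma psi_has_derivative:
  assumes "pi < r" "r < vartheta1"
  shows "(psi has_real_derivative 2 * r * Gf1 (r\<^sup>2)) (at r)"
proof (rule has_field_derivative_transform_within_open[where S = "{0<..}"])
  show "((\<lambda>r. Gf (r\<^sup>2)) has_real_derivative 2 * r * Gf1 (r\<^sup>2)) (at r)"
    by (rule DERIV_cong[OF DERIV_chain2[where g = "\<lambda>r. r\<^sup>2",
            OF Gf_has_derivative[OF power2_in_rho_interval[OF assms]]]])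
      (auto intro!: derivative_eq_intros)
qed (use less_trans[OF pi_gt_zero assms(1)] psi_eq_Gf in auto)

lemma deriv_psi:
  assumes "pi < r" "r < vartheta1"
  shows "deriv psi r / r = 2 * Gf1 (r\<^sup>2)"
  using DERIV_imp_deriv[OF psi_has_derivative[OF assms]] less_trans[OF pi_gt_zero assms(1)] by simp

section \<open>The map \<open>\<Lambda>\<close>\<close>

lemma norm2_square: "(norm (v :: real^2))\<^sup>2 = (v $ 1)\<^sup>2 + (v $ 2)\<^sup>2"
  unfolding power2_norm_eq_inner inner_vec_def sum_2 by (simp add: power2_eq_square)

definition annulus :: "(real^2) set" where
  "annulus = {v. pi < norm v \<and> norm v < vartheta1}"

definition rho :: "real^2 \<Rightarrow> real" where
  "rho v = (v $ 1)\<^sup>2 + (v $ 2)\<^sup>2"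

lemma open_annulus: "open annulus"
  unfolding annulus_def by (intro open_Collect_conj open_Collect_less continuous_intros)

lemma rho_in_interval: "v \<in> annulus \<Longrightarrow> rho v \<in> rho_interval"
  using power2_in_rho_interval[of "norm v"] by (simp add: annulus_def rho_def norm2_square)

lemma annulusI: "rho v \<in> rho_interval \<Longrightarrow> v \<in> annulus"
  using rho_interval_bounds(3,4)[of "rho v"]
  by (simp add: annulus_def rho_def norm2_square[symmetric])

lemma psi_norm:
  assumes "v \<in> annulus"
  shows "psi (norm v) = Gf (rho v)" "deriv psi (norm v) / norm v = 2 * Gf1 (rho v)"
proof -
  have "0 < norm v"
    using assms less_trans[OF pi_gt_zero] by (auto simp: annulus_def)
  then show "psi (norm v) = Gf (rho v)" "deriv psi (norm v) / norm v = 2 * Gf1 (rho v)"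
    using assms deriv_psi[of "norm v"] psi_eq_Gf[of "norm v"]
    by (simp_all add: annulus_def rho_def norm2_square)
qed

lemma K3_eq:
  "v \<in> annulus \<Longrightarrow> K3 v = 2 * (Gf (rho v) + Gf1 (rho v) * (v $ 2)\<^sup>2)"
  by (simp only: K3_def Let_def psi_norm) simp

definition Lambda1 :: "real^2 \<Rightarrow> real" where
  "Lambda1 v = 2 * Gf1 (rho v) * (v $ 2)\<^sup>2 * v $ 1"

definition Lambda2 :: "real^2 \<Rightarrow> real" where
  "Lambda2 v = 2 * v $ 2 * (Gf (rho v) + Gf1 (rho v) * (v $ 2)\<^sup>2)"

lemma Lambda_nth:
  assumes "v \<in> annulus"
  shows "Lambda v $ 1 = Lambda1 v" "Lambda v $ 2 = Lambda2 v"
  by (simp_all only: Lambda_def Let_def psi_norm[OF assms] Lambda1_def Lambda2_def)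
    (simp_all add: axis_def algebra_simps power2_eq_square)

lemma Lambda_eq: "v \<in> annulus \<Longrightarrow> Lambda v = Lambda1 v *\<^sub>R axis 1 1 + Lambda2 v *\<^sub>R axis 2 1"
  by (simp add: vec_eq_iff forall_2 Lambda_nth axis_def)

text \<open>Describes the domain by open conditions in rho and w. From right to left, the K3 bound
  gives v_1^2 = rho - w > pi^2, whence \<open>pi < v $ 1\<close> as v_1 is positive.\<close>

lemma Omega_m4_eq:
  "Omega_m4 = {v \<in> annulus. v $ 2 < 0 \<and> 0 < v $ 1 \<and> Gf (rho v) + Gf1 (rho v) * (v $ 2)\<^sup>2 < 0}"
proof (intro set_eqI iffI)
  fix v assume v: "v \<in> Omega_m4"
  then have "v \<in> annulus"
    by (auto simp: Omega_m4_def annulus_def)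
  with v show "v \<in> {v \<in> annulus. v $ 2 < 0 \<and> 0 < v $ 1 \<and> Gf (rho v) + Gf1 (rho v) * (v $ 2)\<^sup>2 < 0}"
    using less_trans[OF pi_gt_zero, of "v $ 1"] by (auto simp: Omega_m4_def K3_eq)
next
  fix v assume v: "v \<in> {v \<in> annulus. v $ 2 < 0 \<and> 0 < v $ 1 \<and> Gf (rho v) + Gf1 (rho v) * (v $ 2)\<^sup>2 < 0}"
  then have "(v $ 2)\<^sup>2 < rho v - pi\<^sup>2"
    by (intro K3_bound_imp_w_bound rho_in_interval) auto
  then have "pi\<^sup>2 < (v $ 1)\<^sup>2"
    by (simp add: rho_def)
  then have "pi < v $ 1"
    using v by (intro power_less_imp_less_base[of pi 2]) auto
  moreover have "(v $ 1)\<^sup>2 < (norm v)\<^sup>2"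
    using v by (simp add: norm2_square)
  then have "v $ 1 < norm v"
    by (rule power_less_imp_less_base) simp
  ultimately show "v \<in> Omega_m4"
    using v K3_eq[of v] by (auto simp: Omega_m4_def annulus_def)
qed

lemma Omega_m4_subset_annulus: "Omega_m4 \<subseteq> annulus"
  by (auto simp: Omega_m4_eq)

section \<open>Smoothness of \<open>Lambda\<close> and openness of its domain\<close>

lemma smooth_on_vec_nth: "smooth_on S (\<lambda>v :: real^'n. v $ i)"
  by (rule smooth_on_bounded_linear) (rule bounded_linear_vec_nth)

lemma smooth_on_rho: "smooth_on S rho"
  unfolding rho_def by (intro smooth_intros smooth_on_vec_nth)

lemma rho_gt_9: "v \<in> annulus \<Longrightarrow> 9 < rho v"
  using rho_in_interval rho_interval_bounds(1) by blast

lemma smooth_on_qf: "smooth_on annulus (\<lambda>v. qf (rho v))"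
  unfolding qf_def cot_def
  using rho_gt_9 sin_cos_sqrt_neg(1)[OF rho_in_interval]
  by (intro smooth_intros smooth_on_rho) force+

lemma smooth_on_Gf: "smooth_on annulus (\<lambda>v. Gf (rho v))"
  unfolding Gf_def using rho_gt_9 by (intro smooth_intros smooth_on_rho smooth_on_qf) force

lemma smooth_on_Gf1: "smooth_on annulus (\<lambda>v. Gf1 (rho v))"
  unfolding Gf1_def using rho_gt_9 by (intro smooth_intros smooth_on_rho smooth_on_qf) force

lemma smooth_on_Gf2: "smooth_on annulus (\<lambda>v. Gf2 (rho v))"
  unfolding Gf2_def using rho_gt_9 by (intro smooth_intros smooth_on_rho smooth_on_qf) force

lemma smooth_on_Lambda: "smooth_on annulus Lambda"
proof -
  have "smooth_on annulus (\<lambda>v. Lambda1 v *\<^sub>R (axis 1 1 :: real^2) + Lambda2 v *\<^sub>R axis 2 1)"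
    unfolding Lambda1_def Lambda2_def
    by (intro smooth_intros smooth_on_vec_nth smooth_on_Gf smooth_on_Gf1)
  then show ?thesis
    using smooth_on_cong[OF open_annulus, OF Lambda_eq, of "\<lambda>v. v"] by simp
qed

lemma continuous_on_Lambda: "continuous_on annulus Lambda"
  by (rule smooth_on_imp_continuous_on[OF smooth_on_Lambda])

lemma open_Omega_m4: "open Omega_m4"
proof -
  have "continuous_on annulus (\<lambda>v. Gf (rho v) + Gf1 (rho v) * (v $ 2)\<^sup>2)"
    by (intro smooth_on_imp_continuous_on smooth_intros smooth_on_vec_nth smooth_on_Gf smooth_on_Gf1)
  then have "open (annulus \<inter> (\<lambda>v. Gf (rho v) + Gf1 (rho v) * (v $ 2)\<^sup>2) -` {..<0})"
    using open_annulus by (rule continuous_open_preimage) simp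
  moreover have "open {v :: real^2. v $ 2 < 0 \<and> 0 < v $ 1}"
    by (intro open_Collect_conj open_Collect_less continuous_intros)
  ultimately have "open (annulus \<inter> (\<lambda>v. Gf (rho v) + Gf1 (rho v) * (v $ 2)\<^sup>2) -` {..<0}
      \<inter> {v. v $ 2 < 0 \<and> 0 < v $ 1})"
    by (rule open_Int)
  also have "annulus \<inter> (\<lambda>v. Gf (rho v) + Gf1 (rho v) * (v $ 2)\<^sup>2) -` {..<0}
      \<inter> {v. v $ 2 < 0 \<and> 0 < v $ 1} = Omega_m4"
    by (auto simp: Omega_m4_eq)
  finally show ?thesis .
qed

section \<open>The derivative of \<open>Lambda\<close>\<close>

text \<open>Second partial derivatives of v |-> \<open>Gf (rho v) * (v $ 2)\<^sup>2\<close>, whose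
  gradient is \<open>Lambda\<close>; the Jacobian is therefore symmetric.\<close>

definition F11 :: "real^2 \<Rightarrow> real" where
  "F11 v = 2 * (v $ 2)\<^sup>2 * (Gf1 (rho v) + 2 * Gf2 (rho v) * (v $ 1)\<^sup>2)"

definition F12 :: "real^2 \<Rightarrow> real" where
  "F12 v = 4 * v $ 1 * v $ 2 * (Gf1 (rho v) + Gf2 (rho v) * (v $ 2)\<^sup>2)"

definition F22 :: "real^2 \<Rightarrow> real" where
  "F22 v = 2 * Gf (rho v) + 10 * Gf1 (rho v) * (v $ 2)\<^sup>2 + 4 * Gf2 (rho v) * (v $ 2) ^ 4"

lemma rho_has_derivative:
  "(rho has_derivative (\<lambda>h. 2 * v $ 1 * h $ 1 + 2 * v $ 2 * h $ 2)) (at v)"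
  unfolding rho_def
  by (auto intro!: derivative_eq_intros bounded_linear_imp_has_derivative bounded_linear_vec_nth)

lemma Lambda_has_derivative:
  assumes v: "v \<in> annulus"
  shows "(Lambda has_derivative (\<lambda>h. (F11 v * h $ 1 + F12 v * h $ 2) *\<^sub>R axis 1 1
    + (F12 v * h $ 1 + F22 v * h $ 2) *\<^sub>R axis 2 1)) (at v)"
proof (rule has_derivative_transform_within_open[OF _ open_annulus v Lambda_eq[symmetric]])
  note I = rho_in_interval[OF v]
  note nth = bounded_linear_imp_has_derivative[OF bounded_linear_vec_nth]
  note G = DERIV_compose_FDERIV[OF Gf_has_derivative[OF I] rho_has_derivative]
    DERIV_compose_FDERIV[OF Gf1_has_derivative[OF I] rho_has_derivative]
  have 1: "(Lambda1 has_derivative (\<lambda>h. F11 v * h $ 1 + F12 v * h $ 2)) (at v)"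
    unfolding Lambda1_def F11_def F12_def
    by (auto intro!: derivative_eq_intros G nth simp: algebra_simps power2_eq_square)
  have 2: "(Lambda2 has_derivative (\<lambda>h. F12 v * h $ 1 + F22 v * h $ 2)) (at v)"
    unfolding Lambda2_def F22_def F12_def
    by (auto intro!: derivative_eq_intros G nth simp: algebra_simps power2_eq_square eval_nat_numeral)
  show "((\<lambda>v. Lambda1 v *\<^sub>R axis 1 1 + Lambda2 v *\<^sub>R axis 2 1) has_derivative
     (\<lambda>h. (F11 v * h $ 1 + F12 v * h $ 2) *\<^sub>R axis 1 1
    + (F12 v * h $ 1 + F22 v * h $ 2) *\<^sub>R axis 2 1)) (at v)"
    by (intro has_derivative_add has_derivative_scaleR_left 1 2)
qed

lemma Lambda_jacobian_det_neg:
  assumes v: "v \<in> Omega_m4"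
  shows "F11 v * F22 v - (F12 v)\<^sup>2 < 0"
proof -
  define w where "w = (v $ 2)\<^sup>2"
  have I: "rho v \<in> rho_interval" and w: "0 < w" and K: "Gf (rho v) + Gf1 (rho v) * w < 0"
    using v rho_in_interval by (auto simp: Omega_m4_eq w_def)
  have p: "(v $ 1)\<^sup>2 = rho v - w"
    by (simp add: rho_def w_def)
  have F11: "F11 v = 2 * w * (Gf1 (rho v) + 2 * Gf2 (rho v) * (rho v - w))"
    by (simp add: F11_def p flip: w_def)
  have F12: "(F12 v)\<^sup>2 = 16 * (rho v - w) * w * (Gf1 (rho v) + Gf2 (rho v) * w)\<^sup>2"
    by (simp add: F12_def p power_mult_distrib flip: w_def)
  have "(v $ 2) ^ 4 = w\<^sup>2"
    by (simp add: w_def)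
  then have F22: "F22 v = 2 * Gf (rho v) + 10 * Gf1 (rho v) * w + 4 * Gf2 (rho v) * w\<^sup>2"
    by (simp add: F22_def flip: w_def)
  define x g g1 g2 where "x = rho v" and "g = Gf x" and "g1 = Gf1 x" and "g2 = Gf2 x"
  \<comment> \<open>4 w times the affine function of w treated in
    \<open>Lambda_jacobian_neg\<close>.\<close>
  have "F11 v * F22 v - (F12 v)\<^sup>2 = 4 * w * (g1 * g + 9 * g1\<^sup>2 * w + 2 * x * (g2 * g - 2 * g1\<^sup>2)
      + 2 * w * g2 * (x * g1 - g))"
    unfolding F11 F12 F22 x_def[symmetric] g_def[symmetric] g1_def[symmetric] g2_def[symmetric]
    by (simp add: algebra_simps power2_eq_square)
  also have "\<dots> < 0"
    using Lambda_jacobian_neg[OF I w K] w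
    unfolding x_def[symmetric] g_def[symmetric] g1_def[symmetric] g2_def[symmetric]
    by (simp add: mult_pos_neg)
  finally show ?thesis .
qed

section \<open>Injectivity and the smooth inverse\<close>

lemma inj_on_Lambda: "inj_on Lambda Omega_m4"
proof (rule inj_onI)
  fix v v' assume v: "v \<in> Omega_m4" and v': "v' \<in> Omega_m4" and eq: "Lambda v = Lambda v'"
  have a: "v \<in> annulus" "v' \<in> annulus"
    using v v' Omega_m4_subset_annulus by auto
  \<comment> \<open>On the domain v_2 < 0 < v_1, so v is determined by rho and w.\<close>
  have s1: "v $ 1 = sqrt (rho v - (v $ 2)\<^sup>2)" "v' $ 1 = sqrt (rho v' - (v' $ 2)\<^sup>2)"
    using v v' by (auto simp: rho_def Omega_m4_eq)
  have s2: "v $ 2 = - sqrt ((v $ 2)\<^sup>2)" "v' $ 2 = - sqrt ((v' $ 2)\<^sup>2)"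
    using v v' by (auto simp: Omega_m4_eq)
  have "Gf1 (rho v) * (v $ 2)\<^sup>2 * v $ 1 = Gf1 (rho v') * (v' $ 2)\<^sup>2 * v' $ 1"
    using arg_cong[OF eq, of "\<lambda>u. u $ 1"] Lambda_nth(1) a by (simp add: Lambda1_def)
  then have e1: "Gf1 (rho v) * (v $ 2)\<^sup>2 * sqrt (rho v - (v $ 2)\<^sup>2) = Gf1 (rho v') * (v' $ 2)\<^sup>2 * sqrt (rho v' - (v' $ 2)\<^sup>2)"
    by (simp only: s1[symmetric])
  have "(- (v $ 2)) * (Gf (rho v) + Gf1 (rho v) * (v $ 2)\<^sup>2) = (- (v' $ 2)) * (Gf (rho v') + Gf1 (rho v') * (v' $ 2)\<^sup>2)"
    using arg_cong[OF eq, of "\<lambda>u. u $ 2"] Lambda_nth(2) a by (simp add: Lambda2_def)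
  then have e2: "sqrt ((v $ 2)\<^sup>2) * (Gf (rho v) + Gf1 (rho v) * (v $ 2)\<^sup>2) = sqrt ((v' $ 2)\<^sup>2) * (Gf (rho v') + Gf1 (rho v') * (v' $ 2)\<^sup>2)"
    using v v' by (simp add: Omega_m4_eq)
  have "rho v = rho v' \<and> (v $ 2)\<^sup>2 = (v' $ 2)\<^sup>2"
    by (rule u_determines_rho_w[OF rho_in_interval[OF a(1)] rho_in_interval[OF a(2)] _ _ _ _ e1 e2])
      (use v v' in \<open>auto simp: Omega_m4_eq\<close>)
  then show "v = v'"
    using s1 s2 by (simp add: vec_eq_iff forall_2)
qed

lemma smooth_on_Lambda_inverse: "smooth_on (Lambda ` Omega_m4) (the_inv_into Omega_m4 Lambda)"
proof (rule smooth_on_the_inv_into[OF open_Omega_m4 inj_on_Lambda Lambda_has_derivative])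
  let ?D = "\<lambda>v. F11 v * F22 v - (F12 v)\<^sup>2"
  \<comment> \<open>Adjugate formula for the inverse of the symmetric Jacobian.\<close>
  let ?g = "\<lambda>v h :: real^2. ((F22 v * h $ 1 - F12 v * h $ 2) / ?D v) *\<^sub>R axis 1 1
    + ((F11 v * h $ 2 - F12 v * h $ 1) / ?D v) *\<^sub>R (axis 2 1 :: real^2)"
  show "v \<in> annulus" if "v \<in> Omega_m4" for v
    using that Omega_m4_subset_annulus by auto
  have D: "?D v \<noteq> 0" if "v \<in> Omega_m4" for v
    using Lambda_jacobian_det_neg[OF that] by simp
  show "(\<lambda>h. (F11 v * h $ 1 + F12 v * h $ 2) *\<^sub>R axis 1 1 + (F12 v * h $ 1 + F22 v * h $ 2) *\<^sub>R axis 2 1) \<circ> ?g v = id"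
    if "v \<in> Omega_m4" for v
    using D[OF that]
    by (auto simp: fun_eq_iff vec_eq_iff forall_2 axis_def divide_simps) (simp_all add: algebra_simps power2_eq_square)
  show "smooth_on Omega_m4 (\<lambda>v. ?g v i)" for i :: "real^2"
    using D unfolding F11_def F12_def F22_def
    by (intro smooth_intros smooth_on_vec_nth smooth_on_subset[OF _ Omega_m4_subset_annulus]
        smooth_on_Gf smooth_on_Gf1 smooth_on_Gf2) auto
qed

section \<open>Surjectivity\<close>

text \<open>With \<open>m = w G\<^sup>2\<close> the components of \<open>\<Lambda>\<close> stay regular as \<open>\<rho> \<rightarrow> \<pi>\<^sup>2\<close>.\<close>
lemma Lambda_m_coordinates:
  assumes v: "v \<in> Omega_m4"
  defines "m \<equiv> (v $ 2)\<^sup>2 / (Ef (rho v))\<^sup>2"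
  shows "Lambda v $ 1 = 2 * m * Ef1 (rho v) * v $ 1"
    "Lambda v $ 2 = 2 * sqrt m * (1 - m * Ef (rho v) * Ef1 (rho v))"
proof -
  have a: "v \<in> annulus" and v2: "v $ 2 < 0"
    using v by (auto simp: Omega_m4_eq)
  note r = Ef_Gf_relations[OF rho_in_interval[OF a]]
  show "Lambda v $ 1 = 2 * m * Ef1 (rho v) * v $ 1"
    using r(1) by (simp add: Lambda_nth[OF a] Lambda1_def r(3) m_def)
  have sq: "sqrt m = - (v $ 2) / Ef (rho v)"
    using r(1) v2 by (simp add: m_def real_sqrt_divide)
  show "Lambda v $ 2 = 2 * sqrt m * (1 - m * Ef (rho v) * Ef1 (rho v))"
    unfolding sq using r(1) by (simp add: Lambda_nth[OF a] Lambda2_def r(2,3) m_def divide_simps)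
      (simp add: algebra_simps power2_eq_square)
qed

text \<open>Drops the G' term and uses |v_2| <= |v|. As G tends to 0 at
  \<open>vartheta1\<^sup>2\<close>, this forces u_2 to vanish there in the limit.\<close>

lemma Lambda2_less:
  assumes v: "v \<in> Omega_m4"
  shows "Lambda v $ 2 < 2 * norm v * (- Gf (rho v))"
proof -
  have a: "v \<in> annulus" and v2: "v $ 2 < 0"
    using v by (auto simp: Omega_m4_eq)
  note r = Ef_Gf_relations[OF rho_in_interval[OF a]]
  have "Lambda v $ 2 = 2 * (- (v $ 2)) * (- Gf (rho v) - Gf1 (rho v) * (v $ 2)\<^sup>2)"
    by (simp add: Lambda_nth[OF a] Lambda2_def algebra_simps)
  also have "\<dots> < 2 * (- (v $ 2)) * (- Gf (rho v))"
    using v2 r(7) by (intro mult_strict_left_mono) auto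
  also have "\<dots> \<le> 2 * norm v * (- Gf (rho v))"
    using r(6) component_le_norm_cart[of v 2] v2 by (intro mult_right_mono) auto
  finally show ?thesis .
qed

text \<open>The upper bound on u_2: u_2 <= 2 sqrt m because m E E' is positive, and u_1 = m (2 E')
  v_1 > m pi because 2 E' > 1 and v_1 > pi.\<close>

lemma Lambda_in_target:
  assumes v: "v \<in> Omega_m4"
  shows "Lambda v \<in> R2_lt_plus"
proof -
  have a: "v \<in> annulus" and v12: "v $ 2 < 0" "0 < v $ 1" and K: "Gf (rho v) + Gf1 (rho v) * (v $ 2)\<^sup>2 < 0"
    using v by (auto simp: Omega_m4_eq)
  have v1: "pi < v $ 1"
    using v by (simp add: Omega_m4_def)
  note r = Ef_Gf_relations[OF rho_in_interval[OF a]]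
  define m where "m = (v $ 2)\<^sup>2 / (Ef (rho v))\<^sup>2"
  have m: "0 < m"
    using r(1) v12 by (simp add: m_def)
  note L = Lambda_m_coordinates[OF v, folded m_def]
  have pos: "0 < Lambda v $ 1" "0 < Lambda v $ 2"
    using r(7) v12 K by (auto simp: Lambda_nth[OF a] Lambda1_def Lambda2_def mult_neg_neg)
  have "Lambda v $ 2 \<le> 2 * sqrt m * 1"
    unfolding L(2) using m r by (intro mult_left_mono) auto
  also have "m * pi < Lambda v $ 1"
  proof -
    have "m * pi < m * (2 * Ef1 (rho v) * v $ 1)"
      using m r(4) v1 mult_strict_mono[of 1 "2 * Ef1 (rho v)" pi "v $ 1"]
      by (intro mult_strict_left_mono) auto
    then show ?thesis by (simp add: L(1) mult_ac)
  qed
  then have "m < Lambda v $ 1 / pi"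
    by (simp add: field_simps)
  then have "2 * sqrt m * 1 < 2 * sqrt (Lambda v $ 1 / pi)"
    by simp
  finally show ?thesis
    using pos by (simp add: R2_lt_plus_def real_sqrt_divide)
qed

lemma connected_target: "connected R2_lt_plus"
proof -
  \<comment> \<open>Parametrizes the target over a product of intervals, by u_1 and by u_2 as a
    fraction of its upper bound.\<close>
  let ?f = "\<lambda>p :: real \<times> real. fst p *\<^sub>R (axis 1 1 :: real^2) + (snd p * (2 / sqrt pi * sqrt (fst p))) *\<^sub>R axis 2 1"
  have "R2_lt_plus = ?f ` ({0<..} \<times> {0<..<1})"
  proof (intro equalityI subsetI)
    fix u :: "real^2" assume u: "u \<in> R2_lt_plus"
    then have "u = ?f (u $ 1, u $ 2 / (2 / sqrt pi * sqrt (u $ 1)))"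
      by (auto simp: R2_lt_plus_def vec_eq_iff forall_2 axis_def)
    moreover have "(u $ 1, u $ 2 / (2 / sqrt pi * sqrt (u $ 1))) \<in> {0<..} \<times> {0<..<1}"
      using u by (auto simp: R2_lt_plus_def field_simps)
    ultimately show "u \<in> ?f ` ({0<..} \<times> {0<..<1})"
      by (rule image_eqI)
  next
    fix u assume "u \<in> ?f ` ({0<..} \<times> {0<..<1})"
    then show "u \<in> R2_lt_plus"
      by (auto simp: R2_lt_plus_def axis_def divide_strict_right_mono)
  qed
  moreover have "connected (?f ` ({0<..} \<times> {0<..<1}))"
    by (intro connected_continuous_image continuous_intros connected_Times connected_Ioi connected_Ioo)
  ultimately show ?thesis by simp
qed

lemma Omega_m4_nonempty: "Omega_m4 \<noteq> {}"
proof -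
  define x where "x = (pi\<^sup>2 + vartheta1\<^sup>2) / 2"
  have "pi\<^sup>2 < vartheta1\<^sup>2"
    using pi_less_vartheta1 by (intro power_strict_mono) auto
  then have x: "x \<in> rho_interval"
    by (simp add: x_def rho_interval_def)
  note r = Ef_Gf_relations[OF x]
  \<comment> \<open>Half of E/E', the value at which K3 vanishes.\<close>
  define w where "w = Ef x / (2 * Ef1 x)"
  have w: "0 < w"
    using r by (simp add: w_def)
  have K: "Gf x + Gf1 x * w < 0"
    using r(1,4) unfolding w_def r(2,3) by (simp add: divide_simps power2_eq_square)
  have "w < x - pi\<^sup>2"
    using K3_bound_imp_w_bound[OF x] K by simp
  then have p: "0 < x - w"
    by (smt (verit) zero_le_power2)
  define v :: "real^2" where "v = vector [sqrt (x - w), - sqrt w]"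
  have "rho v = x"
    using p w by (simp add: v_def rho_def)
  then have "v \<in> Omega_m4"
    using x w K p annulusI[of v] by (simp add: Omega_m4_eq) (simp add: v_def)
  then show ?thesis by auto
qed

text \<open>A bounded sequence of preimages has a limit point z with pi <= |z| <=
  \<open>vartheta1\<close>. At interior radii continuity gives a preimage; either end radius
  contradicts a strict inequality of the target.\<close>

lemma Lambda_image_closed:
  assumes v: "\<And>n. v n \<in> Omega_m4" and lim: "(\<lambda>n. Lambda (v n)) \<longlonglongrightarrow> l" and l: "l \<in> R2_lt_plus"
  shows "l \<in> Lambda ` Omega_m4"
proof -
  have "v n \<in> cball 0 vartheta1" for n
    using v[of n] by (simp add: Omega_m4_def)
  then obtain z \<sigma> where \<sigma>: "strict_mono (\<sigma> :: nat \<Rightarrow> nat)" and z: "(v \<circ> \<sigma>) \<longlonglongrightarrow> z"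
    using compact_cball[of "0 :: real^2" vartheta1] unfolding compact_def by metis
  define x where "x n = v (\<sigma> n)" for n
  have x: "x n \<in> Omega_m4" for n
    by (simp add: x_def v)
  have xa: "x n \<in> annulus" for n
    using x Omega_m4_subset_annulus by auto
  have xz: "x \<longlonglongrightarrow> z"
    using z unfolding x_def comp_def .
  have xl: "(\<lambda>n. Lambda (x n)) \<longlonglongrightarrow> l"
    using LIMSEQ_subseq_LIMSEQ[OF lim \<sigma>] by (simp add: x_def comp_def)
  have l1: "(\<lambda>n. Lambda (x n) $ 1) \<longlonglongrightarrow> l $ 1" and l2: "(\<lambda>n. Lambda (x n) $ 2) \<longlonglongrightarrow> l $ 2"
    using xl by (auto intro: tendsto_vec_nth)
  have z1: "(\<lambda>n. x n $ 1) \<longlonglongrightarrow> z $ 1" and z2: "(\<lambda>n. x n $ 2) \<longlonglongrightarrow> z $ 2"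
    using xz by (auto intro: tendsto_vec_nth)
  have nz: "(\<lambda>n. norm (x n)) \<longlonglongrightarrow> norm z"
    using xz by (rule tendsto_norm)
  have rz: "(\<lambda>n. rho (x n)) \<longlonglongrightarrow> (norm z)\<^sup>2"
    using tendsto_power[OF nz, of 2] by (simp add: rho_def norm2_square)
  have nzb: "pi \<le> norm z" "norm z \<le> vartheta1"
    using xa by (auto intro!: LIMSEQ_le_const[OF nz] LIMSEQ_le_const2[OF nz] simp: annulus_def less_imp_le)
  consider "z \<in> annulus" | "norm z = pi" | "norm z = vartheta1"
    using nzb by (force simp: annulus_def)
  then show ?thesis
  proof cases
    case 1
    have "isCont Lambda z"
      using continuous_on_Lambda open_annulus 1 continuous_on_eq_continuous_at by blast
    then have "(\<lambda>n. Lambda (x n)) \<longlonglongrightarrow> Lambda z"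
      using xz by (rule isCont_tendsto_compose)
    then have l_eq: "l = Lambda z"
      using xl LIMSEQ_unique by blast
    have "pi \<le> z $ 1"
      using x by (intro LIMSEQ_le_const[OF z1]) (auto simp: Omega_m4_def less_imp_le)
    moreover have "z $ 2 \<le> 0"
      using x by (intro LIMSEQ_le_const2[OF z2]) (auto simp: Omega_m4_def less_imp_le)
    \<comment> \<open>Since z_2 <= 0, positivity of this product makes both z_2 and the K3 factor
      strictly negative.\<close>
    moreover have "0 < 2 * z $ 2 * (Gf (rho z) + Gf1 (rho z) * (z $ 2)\<^sup>2)"
      using l by (simp add: l_eq R2_lt_plus_def Lambda_nth[OF 1] Lambda2_def)
    ultimately have "z \<in> Omega_m4"
      using 1 pi_gt_zero by (auto simp: Omega_m4_eq zero_less_mult_iff simp del: pi_gt_zero)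
    then show ?thesis
      using l_eq by blast
  next
    case 2
    define m where "m n = (x n $ 2)\<^sup>2 / (Ef (rho (x n)))\<^sup>2" for n
    note L = Lambda_m_coordinates[OF x, folded m_def]
    have at_pi: "filterlim (\<lambda>n. rho (x n)) (at (pi\<^sup>2) within rho_interval) sequentially"
      using rz 2 rho_in_interval[OF xa] by (auto simp: filterlim_at rho_interval_def less_imp_neq[THEN not_sym])
    have E: "(\<lambda>n. Ef (rho (x n))) \<longlonglongrightarrow> 0" and E1: "(\<lambda>n. Ef1 (rho (x n))) \<longlonglongrightarrow> 1/2"
      using filterlim_compose[OF Ef_tendsto_at_pi at_pi] filterlim_compose[OF Ef1_tendsto_at_pi at_pi]
      by auto
    \<comment> \<open>Squeezed between pi and |x n|, which tends to pi.\<close>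
    have x1: "(\<lambda>n. x n $ 1) \<longlonglongrightarrow> pi"
      using x nz unfolding 2
      by (intro tendsto_sandwich[OF _ _ tendsto_const nz[unfolded 2]]) (auto simp: Omega_m4_def less_imp_le)
    \<comment> \<open>Solving the formula for u_1 for m shows that m converges, although w and E
      both tend to 0.\<close>
    have "(\<lambda>n. Lambda (x n) $ 1 / (2 * Ef1 (rho (x n)) * x n $ 1)) \<longlonglongrightarrow> l $ 1 / (2 * (1/2) * pi)"
      by (intro tendsto_intros l1 E1 x1) simp
    moreover have "Lambda (x n) $ 1 / (2 * Ef1 (rho (x n)) * x n $ 1) = m n" for n
      using Ef_Gf_relations(4)[OF rho_in_interval[OF xa[of n]]] x[of n] by (simp add: L(1) Omega_m4_eq)
    ultimately have m: "m \<longlonglongrightarrow> l $ 1 / pi"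
      by simp
    \<comment> \<open>With E tending to 0 the limit lies on the curve u_2 = 2 sqrt (u_1 / pi), which
      the target excludes.\<close>
    have "(\<lambda>n. Lambda (x n) $ 2) \<longlonglongrightarrow> 2 * sqrt (l $ 1 / pi) * (1 - l $ 1 / pi * 0 * (1/2))"
      unfolding L(2) by (intro tendsto_intros m E E1)
    then have "l $ 2 = 2 * sqrt (l $ 1 / pi)"
      using l2 LIMSEQ_unique by force
    then show ?thesis
      using l by (simp add: R2_lt_plus_def real_sqrt_divide)
  next
    case 3
    have "filterlim (\<lambda>n. rho (x n)) (at (vartheta1\<^sup>2)) sequentially"
      using rz 3 rho_in_interval[OF xa] by (auto simp: filterlim_at rho_interval_def less_imp_neq)
    then have "(\<lambda>n. Gf (rho (x n))) \<longlonglongrightarrow> 0"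
      by (rule filterlim_compose[OF Gf_tendsto_at_vartheta1])
    then have "(\<lambda>n. 2 * norm (x n) * (- Gf (rho (x n)))) \<longlonglongrightarrow> 2 * norm z * (- 0)"
      by (intro tendsto_intros nz)
    then have "l $ 2 \<le> 0"
      using LIMSEQ_le[OF l2] Lambda2_less[OF x] by (force intro: less_imp_le)
    then show ?thesis
      using l by (simp add: R2_lt_plus_def)
  qed
qed

lemma Lambda_image: "Lambda ` Omega_m4 = R2_lt_plus"
proof -
  have sub: "Lambda ` Omega_m4 \<subseteq> R2_lt_plus"
    using Lambda_in_target by auto
  have "open (Lambda ` Omega_m4)"
    using continuous_on_subset[OF continuous_on_Lambda Omega_m4_subset_annulus] open_Omega_m4 inj_on_Lambda
    by (rule invariance_of_domain)
  then have "openin (top_of_set R2_lt_plus) (Lambda ` Omega_m4)"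
    using sub by (rule open_subset[rotated])
  moreover have "closedin (top_of_set R2_lt_plus) (Lambda ` Omega_m4)"
    unfolding closedin_limpt
  proof (intro conjI sub allI impI)
    fix l assume "l islimpt Lambda ` Omega_m4 \<and> l \<in> R2_lt_plus"
    then obtain y where y: "\<forall>n. y n \<in> Lambda ` Omega_m4" "y \<longlonglongrightarrow> l" "l \<in> R2_lt_plus"
      unfolding islimpt_sequential by blast
    then obtain v where v: "\<And>n. v n \<in> Omega_m4" "\<And>n. y n = Lambda (v n)"
      unfolding image_iff Bex_def by metis
    then have "y = (\<lambda>n. Lambda (v n))" by auto
    then show "l \<in> Lambda ` Omega_m4"
      using y v(1) by (intro Lambda_image_closed[of v]) auto
  qed
  ultimately show ?thesis
    using connected_target Omega_m4_nonempty unfolding connected_clopen by blast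
qed

lemma smooth_diffeo_Lambda: "smooth_diffeo Lambda Omega_m4 R2_lt_plus"
  unfolding smooth_diffeo_def
  using inj_on_Lambda Lambda_image smooth_on_Lambda_inverse
    smooth_on_subset[OF smooth_on_Lambda Omega_m4_subset_annulus]
  by (auto simp: bij_betw_def)

section \<open>The Hessian\<close>

lemma partial_eq:
  assumes "(f has_derivative f') (at x)"
  shows "partial f i x = f' (axis i 1)"
proof -
  have "((\<lambda>s. x + s *\<^sub>R axis i 1) has_derivative (\<lambda>s. s *\<^sub>R axis i 1)) (at 0)"
    by (auto intro!: derivative_eq_intros)
  from has_derivative_compose[OF this, of f f'] assms
  have "((\<lambda>s. f (x + s *\<^sub>R axis i 1)) has_derivative (\<lambda>s. f' (s *\<^sub>R axis i 1))) (at 0)"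
    by simp
  moreover have "(\<lambda>s. f' (s *\<^sub>R axis i 1)) = (*) (f' (axis i 1))"
    using linear_scale[OF has_derivative_linear[OF assms]] by (auto simp: mult.commute)
  ultimately show ?thesis
    unfolding partial_def by (intro DERIV_imp_deriv) (simp add: has_field_derivative_def)
qed

lemma order_linear_factor: "order a [:- b, 1:] = (if a = b then 1 else 0 :: nat)"
  for a b :: real
  using order_power_n_n[of b 1] by (auto intro!: order_0I)

text \<open>A 2 by 2 block of negative determinant has real eigenvalues of opposite signs, and the
  remaining diagonal entry supplies the second positive one.\<close>

lemma block_matrix_signature:
  fixes A :: "real^3^3"
  assumes zero: "A $ 1 $ 3 = 0" "A $ 2 $ 3 = 0" "A $ 3 $ 1 = 0" "A $ 3 $ 2 = 0"
    and neg: "A $ 1 $ 1 * A $ 2 $ 2 - A $ 1 $ 2 * A $ 2 $ 1 < 0" and pos: "0 < A $ 3 $ 3"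
  shows "invertible A \<and> num_pos_eigenvalues A = 2"
proof
  have "det A = (A $ 1 $ 1 * A $ 2 $ 2 - A $ 1 $ 2 * A $ 2 $ 1) * A $ 3 $ 3"
    by (simp add: det_3 zero algebra_simps)
  then have "det A \<noteq> 0"
    using neg pos by simp
  then show "invertible A"
    by (simp add: invertible_det_nz)
next
  define t d c where "t = A $ 1 $ 1 + A $ 2 $ 2" and "d = A $ 1 $ 1 * A $ 2 $ 2 - A $ 1 $ 2 * A $ 2 $ 1"
    and "c = A $ 3 $ 3"
  define \<alpha> \<beta> where "\<alpha> = (t - sqrt (t\<^sup>2 - 4 * d)) / 2" and "\<beta> = (t + sqrt (t\<^sup>2 - 4 * d)) / 2"
  have d: "d < 0" and c: "0 < c"
    using neg pos by (auto simp: d_def c_def)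
  have sq: "(sqrt (t\<^sup>2 - 4 * d))\<^sup>2 = t\<^sup>2 - 4 * d"
    using d by (intro real_sqrt_pow2) (smt (verit) zero_le_power2)
  have sum: "\<alpha> + \<beta> = t" and prod: "\<alpha> * \<beta> = d"
    using sq by (auto simp: \<alpha>_def \<beta>_def field_simps power2_eq_square)
  have "\<alpha> \<le> \<beta>"
    using d order_trans[of "4 * d" 0 "t\<^sup>2"] by (simp add: \<alpha>_def \<beta>_def)
  moreover have "\<alpha> * \<beta> < 0"
    using d prod by simp
  ultimately have signs: "\<alpha> < 0" "0 < \<beta>"
    by (auto simp: mult_less_0_iff)
  have fac: "charpoly A = [:- \<alpha>, 1:] * [:- \<beta>, 1:] * [:- c, 1:]"
  proof -
    have "charpoly A = ([:- (A $ 1 $ 1), 1:] * [:- (A $ 2 $ 2), 1:] - [:A $ 1 $ 2 * A $ 2 $ 1:]) * [:- c, 1:]"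
      by (simp add: charpoly_def det_3 zero c_def algebra_simps)
    also have "[:- (A $ 1 $ 1), 1:] * [:- (A $ 2 $ 2), 1:] - [:A $ 1 $ 2 * A $ 2 $ 1:] = [:d, - t, 1:]"
      by (simp add: d_def t_def)
    also have "\<dots> = [:- \<alpha>, 1:] * [:- \<beta>, 1:]"
      by (simp add: sum[symmetric] prod[symmetric])
    finally show ?thesis .
  qed
  have nz: "[:- \<alpha>, 1:] * [:- \<beta>, 1:] * [:- c, 1:] \<noteq> 0" "[:- \<alpha>, 1:] * [:- \<beta>, 1:] \<noteq> 0"
    by simp_all
  have ord: "order a (charpoly A) = (if a = \<alpha> then 1 else 0) + (if a = \<beta> then 1 else 0) + (if a = c then 1 else 0)" for a
    unfolding fac order_mult[OF nz(1)] order_mult[OF nz(2)] order_linear_factor ..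
  have "{a. a > 0 \<and> poly (charpoly A) a = 0} = {\<beta>, c}"
    unfolding fac poly_mult using signs c by auto
  \<comment> \<open>If the two positive roots coincide, the sum has a single term, of order
    2.\<close>
  then show "num_pos_eigenvalues A = 2"
    unfolding num_pos_eigenvalues_def using signs c by (cases "\<beta> = c") (auto simp: ord)
qed

section \<open>First and second derivatives of \<open>phi\<close> near theta\<close>

definition rho3 :: "real^3 \<Rightarrow> real" where
  "rho3 \<tau> = (\<tau> $ 1)\<^sup>2 + (\<tau> $ 2)\<^sup>2 + (\<tau> $ 3)\<^sup>2"

definition shell :: "(real^3) set" where
  "shell = {\<tau>. pi < norm \<tau> \<and> norm \<tau> < vartheta1}"

lemma open_shell: "open shell"
  unfolding shell_def by (intro open_Collect_conj open_Collect_less continuous_intros)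

lemma norm3_square: "(norm \<tau>)\<^sup>2 = rho3 \<tau>"
  unfolding power2_norm_eq_inner inner_vec_def sum_3 by (simp add: power2_eq_square rho3_def)

lemma rho3_in_interval: "\<tau> \<in> shell \<Longrightarrow> rho3 \<tau> \<in> rho_interval"
  using power2_in_rho_interval[of "norm \<tau>"] by (simp add: shell_def norm3_square)

lemma rho3_has_derivative:
  "(rho3 has_derivative (\<lambda>h. 2 * \<tau> $ 1 * h $ 1 + 2 * \<tau> $ 2 * h $ 2 + 2 * \<tau> $ 3 * h $ 3)) (at \<tau>)"
  unfolding rho3_def
  by (auto intro!: derivative_eq_intros bounded_linear_imp_has_derivative bounded_linear_vec_nth)

text \<open>Uses |tau| cot |tau| = 1 - rho G and cancels G tau_1^2 between the two G terms; the 1/4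
  in t absorbs the factor 4.\<close>

lemma phi_on_shell:
  assumes \<tau>: "\<tau> \<in> shell"
  shows "phi (a *\<^sub>R axis 1 1) ((a\<^sup>2 / 4) *\<^sub>R vector [u $ 1, u $ 2, 0]) \<tau>
    = a\<^sup>2 * (1 - Gf (rho3 \<tau>) * ((\<tau> $ 2)\<^sup>2 + (\<tau> $ 3)\<^sup>2) + u $ 1 * \<tau> $ 1 + (u :: real^2) $ 2 * \<tau> $ 2)"
proof -
  have pos: "0 < norm \<tau>"
    using \<tau> less_trans[OF pi_gt_zero] by (auto simp: shell_def)
  have n: "norm \<tau> = sqrt (rho3 \<tau>)"
    by (simp flip: norm3_square)
  have q: "norm \<tau> * cot (norm \<tau>) = 1 - Gf (rho3 \<tau>) * rho3 \<tau>"
    using rho_interval_bounds(1)[OF rho3_in_interval[OF \<tau>]] by (simp add: Gf_def qf_def n)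
  have psi: "psi (norm \<tau>) = Gf (rho3 \<tau>)"
    using psi_eq_Gf[OF pos] by (simp add: norm3_square)
  have inner1: "\<tau> \<bullet> (a *\<^sub>R axis 1 1) = a * \<tau> $ 1"
    by (simp add: inner_axis)
  have inner2: "((a\<^sup>2 / 4) *\<^sub>R vector [u $ 1, u $ 2, 0]) \<bullet> \<tau> = a\<^sup>2 / 4 * (u $ 1 * \<tau> $ 1 + u $ 2 * \<tau> $ 2)"
    by (simp add: inner_vec_def sum_3 algebra_simps)
  show ?thesis
    unfolding phi_def psi inner1 inner2 mult.assoc q
    by (simp add: norm_axis_1 rho3_def algebra_simps power_mult_distrib)
qed

text \<open>The factor -a^2 keeps the negative sign of the 2 by 2 determinant and turns K3 < 0 into
  a positive corner entry. The term in \<open>u\<close> is linear and drops out of the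
  Hessian.\<close>

lemma phi_hessian_signature:
  fixes u :: "real^2"
  assumes a: "0 < a" and v: "v \<in> Omega_m4"
  defines "H \<equiv> hessian (phi (a *\<^sub>R axis 1 1) ((a\<^sup>2 / 4) *\<^sub>R vector [u $ 1, u $ 2, 0])) (vector [v $ 1, v $ 2, 0])"
  shows "invertible H \<and> num_pos_eigenvalues H = 2"
proof -
  let ?f = "phi (a *\<^sub>R axis 1 1) ((a\<^sup>2 / 4) *\<^sub>R vector [u $ 1, u $ 2, 0])"
  let ?s = "\<lambda>\<tau> :: real^3. (\<tau> $ 2)\<^sup>2 + (\<tau> $ 3)\<^sup>2"
  \<comment> \<open>First partial derivatives on the whole open shell, since differentiating once
    more at theta requires them in a neighbourhood.\<close>
  define P1 where "P1 \<tau> = a\<^sup>2 * (u $ 1 - 2 * \<tau> $ 1 * (Gf1 (rho3 \<tau>) * ?s \<tau>))" for \<tau>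
  define P2 where "P2 \<tau> = a\<^sup>2 * (u $ 2 - 2 * \<tau> $ 2 * (Gf (rho3 \<tau>) + Gf1 (rho3 \<tau>) * ?s \<tau>))" for \<tau>
  define P3 where "P3 \<tau> = a\<^sup>2 * (- 2 * \<tau> $ 3 * (Gf (rho3 \<tau>) + Gf1 (rho3 \<tau>) * ?s \<tau>))" for \<tau>
  note nth = bounded_linear_imp_has_derivative[OF bounded_linear_vec_nth]
  note dG = DERIV_compose_FDERIV[OF Gf_has_derivative[OF rho3_in_interval] rho3_has_derivative]
  note dG1 = DERIV_compose_FDERIV[OF Gf1_has_derivative[OF rho3_in_interval] rho3_has_derivative]
  have df: "(?f has_derivative (\<lambda>h. P1 \<tau> * h $ 1 + P2 \<tau> * h $ 2 + P3 \<tau> * h $ 3)) (at \<tau>)"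
    if \<tau>: "\<tau> \<in> shell" for \<tau>
  proof (rule has_derivative_transform_within_open[OF _ open_shell \<tau> phi_on_shell[symmetric]])
    show "((\<lambda>\<tau>. a\<^sup>2 * (1 - Gf (rho3 \<tau>) * ((\<tau> $ 2)\<^sup>2 + (\<tau> $ 3)\<^sup>2) + u $ 1 * \<tau> $ 1 + u $ 2 * \<tau> $ 2))
        has_derivative (\<lambda>h. P1 \<tau> * h $ 1 + P2 \<tau> * h $ 2 + P3 \<tau> * h $ 3)) (at \<tau>)"
      unfolding P1_def P2_def P3_def
      by (auto intro!: derivative_eq_intros nth dG[OF \<tau>] simp: algebra_simps power2_eq_square)
  qed
  have P: "partial ?f 1 \<tau> = P1 \<tau>" "partial ?f 2 \<tau> = P2 \<tau>" "partial ?f 3 \<tau> = P3 \<tau>" if "\<tau> \<in> shell" for \<tau>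
    by (simp_all only: partial_eq[OF df[OF that]]) (simp_all add: axis_def)
  define \<theta> :: "real^3" where "\<theta> = vector [v $ 1, v $ 2, 0]"
  have \<theta>: "\<theta> $ 1 = v $ 1" "\<theta> $ 2 = v $ 2" "\<theta> $ 3 = 0"
    by (simp_all add: \<theta>_def)
  have r: "rho3 \<theta> = rho v"
    by (simp add: rho3_def rho_def \<theta>)
  have va: "v \<in> annulus" and K: "Gf (rho v) + Gf1 (rho v) * (v $ 2)\<^sup>2 < 0"
    using v by (auto simp: Omega_m4_eq)
  have I: "rho3 \<theta> \<in> rho_interval"
    using rho_in_interval[OF va] by (simp add: r)
  have sh: "\<theta> \<in> shell"
    using rho_interval_bounds(3,4)[OF I] by (simp add: shell_def norm3_square[symmetric])
  \<comment> \<open>At theta the third coordinate is 0, which removes the mixed entries with index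
    3.\<close>
  have 1: "(P1 has_derivative (\<lambda>h. - a\<^sup>2 * (F11 v * h $ 1 + F12 v * h $ 2))) (at \<theta>)"
    unfolding P1_def F11_def F12_def
    by (auto intro!: derivative_eq_intros nth dG[OF sh] dG1[OF sh] simp: \<theta> r algebra_simps power2_eq_square)
  have 2: "(P2 has_derivative (\<lambda>h. - a\<^sup>2 * (F12 v * h $ 1 + F22 v * h $ 2))) (at \<theta>)"
    unfolding P2_def F12_def F22_def
    by (auto intro!: derivative_eq_intros nth dG[OF sh] dG1[OF sh]
        simp: \<theta> r algebra_simps power2_eq_square eval_nat_numeral)
  have 3: "(P3 has_derivative (\<lambda>h. - a\<^sup>2 * (2 * (Gf (rho v) + Gf1 (rho v) * (v $ 2)\<^sup>2) * h $ 3))) (at \<theta>)"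
    unfolding P3_def
    by (auto intro!: derivative_eq_intros nth dG[OF sh] dG1[OF sh] simp: \<theta> r algebra_simps power2_eq_square)
  have "(partial ?f 1 has_derivative (\<lambda>h. - a\<^sup>2 * (F11 v * h $ 1 + F12 v * h $ 2))) (at \<theta>)"
    "(partial ?f 2 has_derivative (\<lambda>h. - a\<^sup>2 * (F12 v * h $ 1 + F22 v * h $ 2))) (at \<theta>)"
    "(partial ?f 3 has_derivative (\<lambda>h. - a\<^sup>2 * (2 * (Gf (rho v) + Gf1 (rho v) * (v $ 2)\<^sup>2) * h $ 3))) (at \<theta>)"
    using has_derivative_transform_within_open[OF 1 open_shell sh P(1)[symmetric]]
      has_derivative_transform_within_open[OF 2 open_shell sh P(2)[symmetric]]
      has_derivative_transform_within_open[OF 3 open_shell sh P(3)[symmetric]] by auto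
  note partial_eq[OF this(1)] partial_eq[OF this(2)] partial_eq[OF this(3)]
  then have ent: "H $ i $ 1 = - a\<^sup>2 * (F11 v * axis i 1 $ 1 + F12 v * axis i 1 $ 2)"
    "H $ i $ 2 = - a\<^sup>2 * (F12 v * axis i 1 $ 1 + F22 v * axis i 1 $ 2)"
    "H $ i $ 3 = - a\<^sup>2 * (2 * (Gf (rho v) + Gf1 (rho v) * (v $ 2)\<^sup>2) * axis i 1 $ 3)" for i
    by (simp_all add: H_def hessian_def flip: \<theta>_def)
  show ?thesis
  proof (rule block_matrix_signature)
    show "H $ 1 $ 1 * H $ 2 $ 2 - H $ 1 $ 2 * H $ 2 $ 1 < 0"
    proof -
      have "H $ 1 $ 1 * H $ 2 $ 2 - H $ 1 $ 2 * H $ 2 $ 1 = (a\<^sup>2)\<^sup>2 * (F11 v * F22 v - (F12 v)\<^sup>2)"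
        by (simp add: ent axis_def algebra_simps power2_eq_square)
      then show ?thesis
        using a Lambda_jacobian_det_neg[OF v] by (simp add: mult_pos_neg)
    qed
    show "0 < H $ 3 $ 3"
      using a K by (simp add: ent axis_def mult_pos_neg)
  qed (simp_all add: ent axis_def)
qed

theorem theorem11p5:
  shows "smooth_diffeo Lambda Omega_m4 R2_lt_plus \<and>
    (\<forall>(a::real) u. a > 0 \<longrightarrow> u \<in> R2_lt_plus \<longrightarrow>
      (let x = a *\<^sub>R (axis 1 1 :: real^3);
           t = (a^2 / 4) *\<^sub>R (vector [u $ 1, u $ 2, 0] :: real^3);
           v = the_inv_into Omega_m4 Lambda u;
           \<theta> = (vector [v $ 1, v $ 2, 0] :: real^3);
           H = hessian (\<lambda>\<tau>. phi x t \<tau>) \<theta>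
       in invertible H \<and> num_pos_eigenvalues H = 2))"
proof (intro conjI allI impI)
  show "smooth_diffeo Lambda Omega_m4 R2_lt_plus"
    by (rule smooth_diffeo_Lambda)
next
  fix a :: real and u :: "real^2" assume a: "0 < a" and u: "u \<in> R2_lt_plus"
  have "the_inv_into Omega_m4 Lambda u \<in> Omega_m4"
    using the_inv_into_into[OF inj_on_Lambda _ subset_refl] u by (simp add: Lambda_image)
  from phi_hessian_signature[OF a this, of u]
  show "let x = a *\<^sub>R (axis 1 1 :: real^3);
           t = (a^2 / 4) *\<^sub>R (vector [u $ 1, u $ 2, 0] :: real^3);
           v = the_inv_into Omega_m4 Lambda u;
           \<theta> = (vector [v $ 1, v $ 2, 0] :: real^3);
           H = hessian (\<lambda>\<tau>. phi x t \<tau>) \<theta>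
       in invertible H \<and> num_pos_eigenvalues H = 2"
    by (simp only: Let_def)
qed

end
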